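(* Let $\mathcal{M}=\mathcal{M}(J,\{n_k\},\{\phi_k\})$ be a Moran class in $\mathbb{R}^d$, where $\phi_k=(c_{k,1},\dots,c_{k,n_k})$, and suppose $c_*=\inf_{i,j}c_{i,j}>0$. Then for every $E\in\mathcal{M}$, $$\dim_A E=s^{**},\qquad\text{where } s^{**}=\lim_{m\to\infty}\Big(\sup_{k\ge 0}s_{k,k+m}\Big).$$
   Context: Assouad dimension: for a metric space $X$ and $0<r<R$, $N_{r,R}(X)$ is the smallest number $N$ such that every ball of radius $R$ in $X$ can be covered by $N$ balls of radius $r$. Then $$\dim_A(X)=\inf\{\alpha\ge 0:\ \exists\, b,c>0 \text{ such that } N_{r,R}(X)\le c(R/r)^\alpha \text{ for all } 0<r<R<b\}.$$ A subset of $\mathbb{R}^d$ is regarded as a metric space with the Euclidean metric. $|A|$ denotes the diameter of a set $A$, and $\mathrm{int}(A)$ its interior. Moran sets: let $\{n_k\}_{k\ge1}$ be a sequence of integers with $n_k\ge 2$. Let $D_k=\{u_1\cdots u_k: 1\le u_j\le n_j,\ j\le k\}$ be the set of words of length $k$, $D_0=\{\emptyset\}$ (the empty word), and $D=\bigcup_{k\ge0}D_k$. Let $J\subset\mathbb{R}^d$ be compact with $\mathrm{int}(J)\ne\varnothing$. For each $k\ge1$ let $\phi_k=(c_{k,1},\dots,c_{k,n_k})$ be a vector of positive reals with $\sum_{j=1}^{n_k}(c_{k,j})^d\le 1$. A collection $\mathcal{F}=\{J_{\mathbf u}:\mathbf u\in D\}$ of closed subsets of $J$ has the Moran structure if: (1)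 for each $\mathbf u\in D$ there is a similarity $S_{\mathbf u}:\mathbb{R}^d\to\mathbb{R}^d$ with $J_{\mathbf u}=S_{\mathbf u}(J)$, and $J_\emptyset=J$; (2) for all $k\ge1$ and $\mathbf u\in D_{k-1}$, the sets $J_{\mathbf u1},\dots,J_{\mathbf un_k}$ are subsets of $J_{\mathbf u}$ with pairwise disjoint interiors, and $|J_{\mathbf ui}|/|J_{\mathbf u}|=c_{k,i}$ for $1\le i\le n_k$. The associated Moran set is $E=\bigcap_{k\ge1}\bigcup_{\mathbf u\in D_k}J_{\mathbf u}$. The Moran class $\mathcal{M}(J,\{n_k\},\{\phi_k\})$ is the class of all Moran sets obtained in this way from the given $J,\{n_k\},\{\phi_k\}$. For integers $k'>k\ge 0$, $s_{k,k'}$ is the unique real solution $s$ of $\Delta_{k,k'}(s)=1$, where $$\Delta_{k,k'}(s)=\prod_{i=k+1}^{k'}\Big(\sum_{j=1}^{n_i}(c_{i,j})^s\Big).$$ Under the assumption $c_*>0$ the sequence $\{\sup_k s_{k,k+m}\}_{m\ge1}$ converges, so $s^{**}$ is well defined. *)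

theory Defs
  imports "HOL-Analysis.Analysis"
begin

text \<open>
  \<open>X\<close> is regarded as a metric space in its own right: the centres of all balls lie in \<open>X\<close>, and a
  ball of the subspace is a ball of the ambient space intersected with \<open>X\<close>. The value is \<open>\<infinity>\<close>
  (the infimum of the empty set) if no finite number of balls suffices uniformly.
\<close>

definition cover_num :: "real \<Rightarrow> real \<Rightarrow> 'a::metric_space set \<Rightarrow> enat" where
  "cover_num r R X =
     Inf {enat N | N. \<forall>x\<in>X. \<exists>C\<subseteq>X. finite C \<and> card C \<le> N \<and>
                        X \<inter> ball x R \<subseteq> (\<Union>y\<in>C. X \<inter> ball y r)}"

definition assouad_dim :: "'a::metric_space set \<Rightarrow> ereal" where
  "assouad_dim X =
     Inf {ereal \<alpha> | \<alpha>. 0 \<le> \<alpha> \<and>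
            (\<exists>b>0. \<exists>c>0. \<forall>r R. 0 < r \<and> r < R \<and> R < b \<longrightarrow>
               ereal_of_enat (cover_num r R X) \<le> ereal (c * (R / r) powr \<alpha>))}"

definition similarity :: "('a::metric_space \<Rightarrow> 'a) \<Rightarrow> bool" where
  "similarity S \<longleftrightarrow> (\<exists>\<rho>>0. \<forall>x y. dist (S x) (S y) = \<rho> * dist x y)"

text \<open>
  The sequences \<open>n k\<close> and \<open>c k j\<close> are indexed by \<open>k \<ge> 1\<close> and \<open>1 \<le> j \<le> n k\<close>; all other values are
  irrelevant. The word \<open>u\<^sub>1\<dots>u\<^sub>k\<close> is the list \<open>[u\<^sub>1,\<dots>,u\<^sub>k]\<close>, so its letter \<open>u\<^sub>j\<close> is \<open>u ! (j - 1)\<close>.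
\<close>

definition words :: "(nat \<Rightarrow> nat) \<Rightarrow> nat \<Rightarrow> nat list set" where
  "words n k = {u. length u = k \<and> (\<forall>j\<in>{1..k}. 1 \<le> u ! (j - 1) \<and> u ! (j - 1) \<le> n j)}"

definition moran_structure ::
  "'a::euclidean_space set \<Rightarrow> (nat \<Rightarrow> nat) \<Rightarrow> (nat \<Rightarrow> nat \<Rightarrow> real) \<Rightarrow> (nat list \<Rightarrow> 'a set) \<Rightarrow> bool"
  where
  "moran_structure J n c F \<longleftrightarrow>
     (\<forall>u\<in>(\<Union>k. words n k). closed (F u) \<and> F u \<subseteq> J) \<and>
     (\<forall>u\<in>(\<Union>k. words n k). \<exists>S. similarity S \<and> F u = S ` J) \<and>
     F [] = J \<and>
     (\<forall>k\<ge>1. \<forall>u\<in>words n (k - 1).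
        (\<forall>i\<in>{1..n k}. F (u @ [i]) \<subseteq> F u) \<and>
        disjoint_family_on (\<lambda>i. interior (F (u @ [i]))) {1..n k} \<and>
        (\<forall>i\<in>{1..n k}. diameter (F (u @ [i])) / diameter (F u) = c k i))"

definition moran_set :: "(nat \<Rightarrow> nat) \<Rightarrow> (nat list \<Rightarrow> 'a set) \<Rightarrow> 'a set" where
  "moran_set n F = (\<Inter>k\<in>{1..}. \<Union>u\<in>words n k. F u)"

definition moran_class ::
  "'a::euclidean_space set \<Rightarrow> (nat \<Rightarrow> nat) \<Rightarrow> (nat \<Rightarrow> nat \<Rightarrow> real) \<Rightarrow> 'a set set" where
  "moran_class J n c = {moran_set n F | F. moran_structure J n c F}"

definition c_star :: "(nat \<Rightarrow> nat) \<Rightarrow> (nat \<Rightarrow> nat \<Rightarrow> real) \<Rightarrow> real" where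
  "c_star n c = Inf {c i j | i j. 1 \<le> i \<and> 1 \<le> j \<and> j \<le> n i}"

definition Delta :: "(nat \<Rightarrow> nat) \<Rightarrow> (nat \<Rightarrow> nat \<Rightarrow> real) \<Rightarrow> nat \<Rightarrow> nat \<Rightarrow> real \<Rightarrow> real" where
  "Delta n c k k' s = (\<Prod>i=k+1..k'. \<Sum>j=1..n i. c i j powr s)"

text \<open>
  Meaningful for \<open>k < k'\<close> only. For \<open>k = k'\<close> the equation is \<open>1 = 1\<close> and the value is arbitrary;
  it contributes only the term \<open>m = 0\<close> to the sequence below and does not affect the limit.
\<close>

definition pre_dim :: "(nat \<Rightarrow> nat) \<Rightarrow> (nat \<Rightarrow> nat \<Rightarrow> real) \<Rightarrow> nat \<Rightarrow> nat \<Rightarrow> real" where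
  "pre_dim n c k k' = (THE s. Delta n c k k' s = 1)"

definition sup_pre_dim :: "(nat \<Rightarrow> nat) \<Rightarrow> (nat \<Rightarrow> nat \<Rightarrow> real) \<Rightarrow> nat \<Rightarrow> real" where
  "sup_pre_dim n c m = (SUP k. pre_dim n c k (k + m))"

definition s_star_star :: "(nat \<Rightarrow> nat) \<Rightarrow> (nat \<Rightarrow> nat \<Rightarrow> real) \<Rightarrow> real" where
  "s_star_star n c = lim (sup_pre_dim n c)"

end

theory Submission imports Defs begin

text \<open>
  By multiplicativity of \<open>Delta\<close> in the levels, a Fekete type argument shows that
  \<open>sup_pre_dim n c m\<close> converges to its infimum over \<open>m \<ge> 1\<close>; moreover
  \<open>sup_pre_dim n c m \<le> s\<close> iff \<open>Delta n c k (k + m) s \<le> 1\<close> for all \<open>k\<close>.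

  Upper bound: if \<open>\<alpha>\<close> exceeds this limit, \<open>Delta n c k (k + m) \<alpha>\<close> is bounded in \<open>k\<close> and \<open>m\<close>. Cutting the
  tree below a set of size comparable to \<open>R\<close> at size comparable to \<open>r\<close> thus gives at most a constant
  times \<open>(R / r) powr \<alpha>\<close> pieces, and by volume comparison a ball of radius \<open>R\<close> meets boundedly many
  pieces of size comparable to \<open>R\<close>.

  Lower bound: if \<open>\<alpha>\<close> is admissible in the definition of the Assouad dimension and \<open>s > \<alpha>\<close>, group
  the descendants of a word \<open>m\<close> levels down by size. Volume comparison bounds the number of those of
  relative size about \<open>cmax ^ i\<close> by a constant times \<open>(cmax ^ i) powr - \<alpha>\<close>, and only \<open>i \<ge> m\<close> occur. So
  \<open>Delta n c k (k + m) s\<close> is at most the tail of a convergent geometric series, hence \<open>\<le> 1\<close> for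
  large \<open>m\<close>, uniformly in \<open>k\<close>.
\<close>

subsection \<open>The numbers \<open>s\<^sub>k\<^sub>,\<^sub>k\<^sub>+\<^sub>m\<close> and their limit\<close>

locale moran_ratios =
  fixes n :: "nat \<Rightarrow> nat" and c :: "nat \<Rightarrow> nat \<Rightarrow> real" and d :: nat
  assumes d_pos: "0 < d"
    and n_ge: "\<And>k. 1 \<le> k \<Longrightarrow> 2 \<le> n k"
    and c_pos: "\<And>k j. 1 \<le> k \<Longrightarrow> 1 \<le> j \<Longrightarrow> j \<le> n k \<Longrightarrow> 0 < c k j"
    and c_sum: "\<And>k. 1 \<le> k \<Longrightarrow> (\<Sum>j=1..n k. c k j ^ d) \<le> 1"
    and c_star_pos: "0 < c_star n c"
begin

section \<open>Uniform bounds on contraction ratios and branching numbers\<close>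

abbreviation "cs \<equiv> c_star n c"

text \<open>A uniform bound below 1 on all ratios: every level has a second ratio, whose
  \<open>d\<close>-th power takes up at least \<open>cs ^ d\<close> of the total 1.\<close>

definition cmax :: real where "cmax = root d (1 - cs ^ d)"

text \<open>A uniform bound on the branching numbers: \<open>n k\<close> terms, each at least
  \<open>cs ^ d\<close>, sum to at most 1.\<close>

definition nmax :: real where "nmax = 1 / cs ^ d"

lemma cs_le: assumes "1 \<le> k" "1 \<le> j" "j \<le> n k" shows "cs \<le> c k j"
  unfolding c_star_def
proof (rule cInf_lower)
  show "bdd_below {c i j |i j. 1 \<le> i \<and> 1 \<le> j \<and> j \<le> n i}"
    using c_pos by (auto intro!: bdd_belowI[of _ 0] less_imp_le)
qed (use assms in auto)

lemma cs_sum: assumes "1 \<le> k" shows "real (n k) * cs ^ d \<le> 1"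
proof -
  have "real (n k) * cs ^ d = (\<Sum>j=1..n k. cs ^ d)" by simp
  also have "\<dots> \<le> (\<Sum>j=1..n k. c k j ^ d)"
    using cs_le assms c_star_pos by (intro sum_mono power_mono) auto
  also have "\<dots> \<le> 1" using c_sum assms by simp
  finally show ?thesis .
qed

text \<open>Level 1 already has two ratios. This keeps \<open>1 - cs ^ d\<close> positive, so that
  \<open>cmax\<close> is positive.\<close>

lemma cs_pow: "2 * cs ^ d \<le> 1"
proof -
  have "2 * cs ^ d \<le> real (n 1) * cs ^ d"
    using n_ge[of 1] c_star_pos by (intro mult_right_mono) auto
  then show ?thesis using cs_sum[of 1] by simp
qed

lemma nmax_ge1: "1 \<le> nmax" and n_le_nmax: "1 \<le> k \<Longrightarrow> real (n k) \<le> nmax"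
  using cs_pow cs_sum[of k] c_star_pos unfolding nmax_def by (auto simp: field_simps)

lemma cmax_bounds: "0 < cmax" "cmax < 1"
proof -
  have "0 < cs ^ d" using c_star_pos by simp
  then show "0 < cmax" "cmax < 1" unfolding cmax_def using cs_pow d_pos by auto
qed

lemma cmax_powr_less_1: "0 < e \<Longrightarrow> cmax powr e < 1"
  using powr_less_mono2[of e cmax 1] cmax_bounds by simp

lemma c_le_cmax: assumes "1 \<le> k" "1 \<le> j" "j \<le> n k" shows "c k j \<le> cmax"
proof -
  obtain i where i: "i \<in> {1..n k}" "i \<noteq> j"
    using n_ge[OF assms(1)] by (intro that[of "if j = 1 then 2 else 1"]) auto
  have "c k i ^ d + c k j ^ d = (\<Sum>l\<in>{i,j}. c k l ^ d)" using i by simp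
  also have "\<dots> \<le> (\<Sum>l=1..n k. c k l ^ d)"
    using i assms c_pos by (intro sum_mono2) (auto intro: less_imp_le)
  also have "\<dots> \<le> 1" using c_sum assms by simp
  finally have "c k j ^ d \<le> 1 - c k i ^ d" by simp
  moreover have "cs ^ d \<le> c k i ^ d" using cs_le i assms c_star_pos by (intro power_mono) auto
  ultimately have "c k j ^ d \<le> 1 - cs ^ d" by simp
  then have "root d (c k j ^ d) \<le> cmax" unfolding cmax_def using d_pos by simp
  then show ?thesis using d_pos c_pos[OF assms] by (simp add: real_root_power_cancel)
qed

section \<open>Multiplicativity and decay of \<open>Delta\<close>\<close>

lemma Delta_0 [simp]: "Delta n c k k s = 1"
  by (simp add: Delta_def)

lemma Delta_Suc:
  "Delta n c k (k + Suc m) s = Delta n c k (k + m) s * (\<Sum>j=1..n (k + Suc m). c (k + Suc m) j powr s)"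
  unfolding Delta_def by simp

lemma Delta_add:
  "Delta n c k (k + (m + l)) s = Delta n c k (k + m) s * Delta n c (k + m) (k + m + l) s"
  unfolding Delta_def
  using prod.ub_add_nat[of "k+1" "k+m" "\<lambda>i. \<Sum>j=1..n i. c i j powr s" l] by (simp add: add.assoc)

lemma sum_c_pos: "1 \<le> k \<Longrightarrow> 0 < (\<Sum>j=1..n k. c k j powr s)"
  using n_ge[of k] c_pos[of k] by (intro sum_pos) (auto simp: less_le)

lemma Delta_pos: "0 < Delta n c k (k + m) s"
  unfolding Delta_def by (intro prod_pos ballI sum_c_pos) auto

text \<open>A factor \<open>cmax powr e\<close> can be pulled out of the sum at each of the
  \<open>m\<close> levels. This quantifies the decay in the exponent.\<close>

lemma Delta_shift: assumes "0 \<le> e"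
  shows "Delta n c k (k + m) (s + e) \<le> (cmax powr e) ^ m * Delta n c k (k + m) s"
proof -
  have "Delta n c k (k + m) (s + e) \<le> (\<Prod>i=k+1..k+m. cmax powr e * (\<Sum>j=1..n i. c i j powr s))"
    unfolding Delta_def
  proof (intro prod_mono conjI)
    fix i assume i: "i \<in> {k+1..k+m}"
    show "(\<Sum>j=1..n i. c i j powr (s + e)) \<le> cmax powr e * (\<Sum>j=1..n i. c i j powr s)"
      unfolding sum_distrib_left
    proof (rule sum_mono)
      fix j assume "j \<in> {1..n i}"
      then show "c i j powr (s + e) \<le> cmax powr e * c i j powr s"
        using c_le_cmax[of i j] c_pos[of i j] i assms
        by (auto simp: powr_add mult.commute intro!: mult_right_mono powr_mono2)
    qed
  qed (auto intro!: sum_nonneg)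
  also have "\<dots> = (cmax powr e) ^ m * Delta n c k (k + m) s"
    by (simp add: Delta_def prod.distrib)
  finally show ?thesis .
qed

lemma Delta_strict_mono: assumes "0 < m" "s < t"
  shows "Delta n c k (k + m) t < Delta n c k (k + m) s"
proof -
  have "(cmax powr (t - s)) ^ m < 1"
    using assms cmax_powr_less_1[of "t - s"] by (simp add: power_less_one_iff)
  then have "(cmax powr (t - s)) ^ m * Delta n c k (k + m) s < Delta n c k (k + m) s"
    using Delta_pos[of k m s] by simp
  then show ?thesis using Delta_shift[of "t - s" k m s] assms by simp
qed

lemma Delta_le_nmax: assumes "0 \<le> s" shows "Delta n c k (k + m) s \<le> nmax ^ m"
proof -
  have "Delta n c k (k + m) s \<le> (\<Prod>i=k+1..k+m. nmax)"
    unfolding Delta_def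
  proof (intro prod_mono conjI)
    fix i assume i: "i \<in> {k+1..k+m}"
    have "(\<Sum>j=1..n i. c i j powr s) \<le> (\<Sum>j=1..n i. 1)"
      using c_le_cmax[of i] c_pos[of i] cmax_bounds i assms
      by (intro sum_mono powr_le1) (fastforce intro: less_imp_le)+
    then show "(\<Sum>j=1..n i. c i j powr s) \<le> nmax" using n_le_nmax[of i] i by simp
  qed (auto intro!: sum_nonneg)
  then show ?thesis by simp
qed

text \<open>Each block of \<open>m\<close> levels split off from the top costs a factor of at most
  \<theta>; the fewer than \<open>m\<close> levels that remain are bounded crudely by
  \<open>nmax ^ m\<close>.\<close>

lemma Delta_blocks:
  assumes "0 < m" "0 \<le> s" "\<theta> \<le> 1" "\<And>k. Delta n c k (k + m) s \<le> \<theta>"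
  shows "Delta n c k (k + N) s \<le> nmax ^ m * \<theta> ^ (N div m)"
proof (induction N arbitrary: k rule: less_induct)
  case (less N)
  show ?case
  proof (cases "N < m")
    case True
    have "Delta n c k (k + N) s \<le> nmax ^ N" by (rule Delta_le_nmax[OF assms(2)])
    also have "\<dots> \<le> nmax ^ m" using True nmax_ge1 by (intro power_increasing) auto
    finally show ?thesis using True by simp
  next
    case False
    then obtain l where l: "N = m + l" using le_Suc_ex not_less by blast
    have \<theta>: "0 \<le> \<theta>" using Delta_pos[of 0 m s] assms(4)[of 0] by simp
    have "Delta n c k (k + N) s = Delta n c k (k + m) s * Delta n c (k + m) (k + m + l) s"
      unfolding l by (rule Delta_add)
    also have "\<dots> \<le> \<theta> * (nmax ^ m * \<theta> ^ (l div m))"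
      using less.IH[of l "k + m"] l assms(1,4) \<theta> Delta_pos[of "k + m" l s]
      by (intro mult_mono) (auto intro: less_imp_le)
    also have "\<dots> = nmax ^ m * \<theta> ^ (N div m)" using l assms(1) by simp
    finally show ?thesis .
  qed
qed

section \<open>The roots and the convergence of their suprema\<close>

lemma pre_dim_root:
  assumes "0 < m"
  shows "Delta n c k (k + m) (pre_dim n c k (k + m)) = 1"
    and pre_dim_bounds: "0 \<le> pre_dim n c k (k + m)" "pre_dim n c k (k + m) \<le> real d"
proof -
  let ?D = "Delta n c k (k + m)"
  \<comment> \<open>At exponent 0 each factor counts the children, at exponent \<open>d\<close> it
    is at most 1. A root lies between, and strict monotonicity makes it unique, so
    \<open>THE\<close> in \<open>pre_dim\<close> is meaningful.\<close>
  have "1 \<le> ?D 0" unfolding Delta_def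
  proof (intro prod_ge_1)
    fix i assume i: "i \<in> {k+1..k+m}"
    have "(\<Sum>j=1..n i. c i j powr 0) = real (n i)"
      using c_pos[of i] i by (subst sum.cong[OF refl, where h = "\<lambda>_. 1"]) fastforce+
    then show "1 \<le> (\<Sum>j=1..n i. c i j powr 0)" using n_ge[of i] i by simp
  qed
  moreover have "?D (real d) \<le> 1" unfolding Delta_def
  proof (intro prod_le_1 conjI)
    fix i assume i: "i \<in> {k+1..k+m}"
    have "(\<Sum>j=1..n i. c i j powr real d) = (\<Sum>j=1..n i. c i j ^ d)"
      using c_pos[of i] i by (intro sum.cong) (auto simp: powr_realpow)
    then show "(\<Sum>j=1..n i. c i j powr real d) \<le> 1" using c_sum[of i] i by simp
  qed (auto intro!: sum_nonneg)
  moreover have "continuous_on {0..real d} ?D"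
    unfolding Delta_def using c_pos
    by (intro continuous_intros ballI) (metis add_leD2 atLeastAtMost_iff less_irrefl)
  ultimately obtain s where s: "0 \<le> s" "s \<le> real d" "?D s = 1"
    using IVT2'[of ?D "real d" 1 0] by auto
  have "t = s" if "?D t = 1" for t
    using Delta_strict_mono[OF assms, of s t k] Delta_strict_mono[OF assms, of t s k] s(3) that
    by (cases t s rule: linorder_cases) auto
  then have "pre_dim n c k (k + m) = s" unfolding pre_dim_def using s(3) by blast
  then show "?D (pre_dim n c k (k + m)) = 1" "0 \<le> pre_dim n c k (k + m)"
    "pre_dim n c k (k + m) \<le> real d" using s by auto
qed

lemma pre_dim_le_iff:
  assumes "0 < m" shows "pre_dim n c k (k + m) \<le> s \<longleftrightarrow> Delta n c k (k + m) s \<le> 1"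
  using pre_dim_root[OF assms, of k] Delta_strict_mono[OF assms, of s "pre_dim n c k (k + m)" k]
    Delta_strict_mono[OF assms, of "pre_dim n c k (k + m)" s k]
  by (cases "pre_dim n c k (k + m)" s rule: linorder_cases) auto

lemma sup_pre_dim_le_iff:
  assumes "0 < m"
  shows "sup_pre_dim n c m \<le> s \<longleftrightarrow> (\<forall>k. Delta n c k (k + m) s \<le> 1)"
  unfolding sup_pre_dim_def
  using pre_dim_bounds(2)[OF assms]
  by (subst cSUP_le_iff) (auto simp: pre_dim_le_iff[OF assms] intro!: bdd_aboveI[of _ "real d"])

lemma sup_pre_dim_nonneg: assumes "0 < m" shows "0 \<le> sup_pre_dim n c m"
proof -
  have "pre_dim n c 0 (0 + m) \<le> sup_pre_dim n c m"
    using sup_pre_dim_le_iff[OF assms] pre_dim_le_iff[OF assms] by blast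
  then show ?thesis using pre_dim_bounds(1)[OF assms, of 0] by linarith
qed

text \<open>The Fekete step: raising the exponent slightly above \<open>sup_pre_dim n c m\<close>
  makes every block of \<open>m\<close> levels at most some \<theta> < 1, and sufficiently many
  blocks outweigh the constant \<open>nmax ^ m\<close> of the incomplete block.\<close>

lemma sup_pre_dim_eventually_less:
  assumes "0 < m" "sup_pre_dim n c m < a"
  shows "eventually (\<lambda>N. sup_pre_dim n c N < a) sequentially"
proof -
  define s where "s = sup_pre_dim n c m"
  obtain t where t: "s < t" "t < a" using assms(2) dense s_def by blast
  define \<theta> where "\<theta> = (cmax powr (t - s)) ^ m"
  have t0: "0 \<le> t" using sup_pre_dim_nonneg[OF assms(1)] t s_def by simp
  have \<theta>: "0 \<le> \<theta>" "\<theta> < 1"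
    unfolding \<theta>_def using cmax_powr_less_1[of "t - s"] t assms(1)
    by (auto simp: power_less_one_iff)
  have D: "Delta n c k (k + m) t \<le> \<theta>" for k
  proof -
    have "Delta n c k (k + m) s \<le> 1" using sup_pre_dim_le_iff[OF assms(1), of s] s_def by simp
    then have "(cmax powr (t - s)) ^ m * Delta n c k (k + m) s \<le> \<theta> * 1"
      unfolding \<theta>_def by (intro mult_left_mono) auto
    then show ?thesis using Delta_shift[of "t - s" k m s] t by simp
  qed
  have "0 < 1 / nmax ^ m" using nmax_ge1 by simp
  then obtain p where p: "\<theta> ^ p < 1 / nmax ^ m"
    using real_arch_pow_inv \<theta>(2) by blast
  \<comment> \<open>\<open>Suc p\<close> rather than \<open>p\<close> keeps \<open>N\<close>
    positive even if \<open>p = 0\<close>.\<close>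
  have "sup_pre_dim n c N < a" if N: "N \<ge> Suc p * m" for N
  proof -
    have "p \<le> N div m"
      using N assms(1) by (simp add: less_eq_div_iff_mult_less_eq)
    then have "\<theta> ^ (N div m) \<le> \<theta> ^ p" using \<theta> by (intro power_decreasing) auto
    then have "nmax ^ m * \<theta> ^ (N div m) \<le> nmax ^ m * (1 / nmax ^ m)"
      using p nmax_ge1 by (intro mult_left_mono) auto
    also have "\<dots> = 1" using nmax_ge1 by simp
    finally have "Delta n c k (k + N) t \<le> 1" for k
      using Delta_blocks[OF assms(1) t0 _ D, of k N] \<theta> by simp
    moreover have "0 < N" using N assms(1) by (cases N) auto
    ultimately have "sup_pre_dim n c N \<le> t" by (simp add: sup_pre_dim_le_iff)
    then show ?thesis using t by simp
  qed
  then show ?thesis unfolding eventually_sequentially by blast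
qed

lemma sup_pre_dim_tendsto: "sup_pre_dim n c \<longlonglongrightarrow> (INF m\<in>{0<..}. sup_pre_dim n c m)"
proof (rule order_tendstoI)
  let ?L = "INF m\<in>{0<..}. sup_pre_dim n c m"
  have bdd: "bdd_below (sup_pre_dim n c ` {0<..})"
    using sup_pre_dim_nonneg by (auto intro!: bdd_belowI[of _ 0])
  { fix a assume "a < ?L"
    then have "a < sup_pre_dim n c N" if "N > 0" for N
      using cINF_lower[OF bdd, of N] that by simp
    then show "eventually (\<lambda>N. a < sup_pre_dim n c N) sequentially"
      using eventually_gt_at_top[of 0] by (rule eventually_mono[rotated]) }
  { fix a assume "?L < a"
    then obtain m where "0 < m" "sup_pre_dim n c m < a"
      using cINF_less_iff[OF _ bdd, of a] by auto
    then show "eventually (\<lambda>N. sup_pre_dim n c N < a) sequentially"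
      by (rule sup_pre_dim_eventually_less) }
qed

lemma convergent_sup_pre_dim: "convergent (sup_pre_dim n c)"
  using sup_pre_dim_tendsto by (auto simp: convergent_def)

lemma s_star_star_eq: "s_star_star n c = (INF m\<in>{0<..}. sup_pre_dim n c m)"
  unfolding s_star_star_def using sup_pre_dim_tendsto by (rule limI)

lemma s_star_star_le:
  assumes "0 < m" "\<And>k. Delta n c k (k + m) s \<le> 1" shows "s_star_star n c \<le> s"
proof -
  have "bdd_below (sup_pre_dim n c ` {0<..})"
    using sup_pre_dim_nonneg by (auto intro!: bdd_belowI[of _ 0])
  then have "s_star_star n c \<le> sup_pre_dim n c m"
    unfolding s_star_star_eq using assms(1) by (intro cINF_lower) auto
  then show ?thesis using sup_pre_dim_le_iff[OF assms(1), of s] assms(2) by simp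
qed

lemma s_star_star_nonneg: "0 \<le> s_star_star n c"
  unfolding s_star_star_eq using sup_pre_dim_nonneg by (intro cINF_greatest) auto

text \<open>The limit is an infimum, so some block length \<open>m\<close> already has all its
  blocks at most 1 at exponent \<open>s\<close>; then \<open>Delta_blocks\<close> applies with
  \<theta> = 1.\<close>

lemma Delta_bounded:
  assumes "s_star_star n c < s"
  obtains B where "\<And>k m. Delta n c k (k + m) s \<le> B"
proof -
  have s: "0 \<le> s" using assms s_star_star_nonneg by simp
  have "bdd_below (sup_pre_dim n c ` {0<..})"
    using sup_pre_dim_nonneg by (auto intro!: bdd_belowI[of _ 0])
  then obtain m where m: "0 < m" "sup_pre_dim n c m < s"
    using assms unfolding s_star_star_eq by (subst (asm) cINF_less_iff) auto
  then have "\<And>k. Delta n c k (k + m) s \<le> 1"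
    using sup_pre_dim_le_iff[OF m(1), of s] by simp
  from that[OF Delta_blocks[OF m(1) s order_refl this, simplified]] show ?thesis .
qed

end

subsection \<open>Balls, similarities and words\<close>

text \<open>The volumes of the disjoint small balls add up to at most the volume of the large one;
  the volume of the unit ball cancels.\<close>

lemma card_disjoint_balls_le:
  fixes z :: "'i \<Rightarrow> 'a::euclidean_space"
  assumes "finite V" "0 \<le> e" "0 \<le> D" "disjoint_family_on (\<lambda>v. ball (z v) e) V"
    and "\<And>v. v \<in> V \<Longrightarrow> ball (z v) e \<subseteq> ball y D"
  shows "real (card V) * e ^ DIM('a) \<le> D ^ DIM('a)"
proof -
  let ?w = "unit_ball_vol (real DIM('a))"
  have "measure lborel (\<Union>v\<in>V. ball (z v) e) = (\<Sum>v\<in>V. measure lborel (ball (z v) e))"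
    using assms(1,4) emeasure_lborel_ball_finite
    by (intro measure_finite_Union) (auto simp: less_top[symmetric])
  also have "\<dots> = ?w * (real (card V) * e ^ DIM('a))"
    using assms(2) by (simp add: content_ball)
  finally have "?w * (real (card V) * e ^ DIM('a)) = measure lborel (\<Union>v\<in>V. ball (z v) e)" ..
  also have "\<dots> \<le> measure lborel (ball y D)"
    using assms(1,5) emeasure_lborel_ball_finite[of y D]
    by (intro measure_mono_fmeasurable fmeasurableI) auto
  also have "\<dots> = ?w * D ^ DIM('a)" using assms(3) by (simp add: content_ball)
  finally show ?thesis by simp
qed

text \<open>The point is surjectivity: normalised to fix 0 and to preserve distances,
  \<open>S\<close> becomes an orthogonal transformation.\<close>

lemma similarity_ball_image:
  fixes S :: "'a::euclidean_space \<Rightarrow> 'a"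
  assumes "0 < r" "\<And>x y. dist (S x) (S y) = r * dist x y"
  shows "S ` ball x e = ball (S x) (r * e)"
proof -
  define f where "f x = (1 / r) *\<^sub>R (S x - S 0)" for x
  have "dist (f x) (f y) = dist x y" for x y
  proof -
    have "f x - f y = (1 / r) *\<^sub>R (S x - S y)" unfolding f_def by (simp add: algebra_simps)
    then have "dist (f x) (f y) = (1 / r) * dist (S x) (S y)"
      using assms(1) by (simp add: dist_norm)
    then show ?thesis using assms by simp
  qed
  moreover have "f 0 = 0" by (simp add: f_def)
  ultimately have "orthogonal_transformation f"
    by (simp add: orthogonal_transformation_isometry)
  then have "surj f" by (rule orthogonal_transformation_surj)
  have "\<exists>x. S x = y" for y
  proof -
    obtain x where "f x = (1 / r) *\<^sub>R (y - S 0)" using \<open>surj f\<close> by (metis surjD)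
    then have "S x = y" unfolding f_def using assms(1) by simp
    then show ?thesis ..
  qed
  then have "w \<in> S ` ball x e" if "w \<in> ball (S x) (r * e)" for w
    using that assms by (metis (no_types, lifting) image_eqI mem_ball mult_less_cancel_left_pos)
  then show ?thesis using assms by auto
qed

lemma cover_num_leI:
  assumes "0 \<le> K" "\<And>x. x \<in> X \<Longrightarrow> \<exists>C\<subseteq>X. finite C \<and> real (card C) \<le> K \<and> X \<inter> ball x R \<subseteq> (\<Union>y\<in>C. ball y r)"
  shows "ereal_of_enat (cover_num r R X) \<le> ereal K"
proof -
  have "\<exists>C\<subseteq>X. finite C \<and> card C \<le> nat \<lfloor>K\<rfloor> \<and> X \<inter> ball x R \<subseteq> (\<Union>y\<in>C. X \<inter> ball y r)" if x: "x \<in> X" for x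
  proof -
    obtain C where "C \<subseteq> X" "finite C" "real (card C) \<le> K" "X \<inter> ball x R \<subseteq> (\<Union>y\<in>C. ball y r)"
      using assms(2)[OF x] by blast
    then show ?thesis by (intro exI[of _ C]) (auto simp: le_nat_floor)
  qed
  then have "cover_num r R X \<le> enat (nat \<lfloor>K\<rfloor>)"
    unfolding cover_num_def by (intro Inf_lower) blast
  then have "ereal_of_enat (cover_num r R X) \<le> ereal_of_enat (enat (nat \<lfloor>K\<rfloor>))"
    by (simp only: ereal_of_enat_le_iff)
  also have "\<dots> \<le> ereal K" using assms(1) by simp
  finally show ?thesis .
qed

text \<open>A finite bound excludes the empty set, whose infimum is infinite; a nonempty set of
  extended naturals attains its infimum.\<close>

lemma cover_num_leD:
  assumes "ereal_of_enat (cover_num r R X) \<le> ereal K" "x \<in> X"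
  obtains C where "C \<subseteq> X" "finite C" "real (card C) \<le> K" "X \<inter> ball x R \<subseteq> (\<Union>y\<in>C. ball y r)"
proof -
  let ?A = "{enat N | N. \<forall>x\<in>X. \<exists>C\<subseteq>X. finite C \<and> card C \<le> N \<and>
                        X \<inter> ball x R \<subseteq> (\<Union>y\<in>C. X \<inter> ball y r)}"
  have "?A \<noteq> {}"
  proof
    assume "?A = {}"
    then have "cover_num r R X = \<infinity>"
      unfolding cover_num_def by (simp only: Inf_empty top_enat_def)
    then show False using assms(1) by simp
  qed
  then have "Inf ?A \<in> ?A" by (metis (no_types, lifting) Inf_enat_def LeastI_ex ex_in_conv)
  then obtain N where N: "cover_num r R X = enat N" and
    C: "\<forall>x\<in>X. \<exists>C\<subseteq>X. finite C \<and> card C \<le> N \<and> X \<inter> ball x R \<subseteq> (\<Union>y\<in>C. X \<inter> ball y r)"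
    unfolding cover_num_def by blast
  obtain C where "C\<subseteq>X" "finite C" "card C \<le> N" "X \<inter> ball x R \<subseteq> (\<Union>y\<in>C. X \<inter> ball y r)"
    using C assms(2) by blast
  moreover have "real N \<le> K" using assms(1) N by simp
  ultimately show ?thesis by (intro that[of C]) auto
qed

section \<open>Words and estimates for powers\<close>

lemma words_0 [simp]: "words n 0 = {[]}"
  by (auto simp: words_def)

lemma snoc_in_words_iff:
  "u @ [i] \<in> words n (Suc k) \<longleftrightarrow> u \<in> words n k \<and> i \<in> {1..n (Suc k)}"
  unfolding words_def by (auto simp: atLeastAtMostSuc_conv nth_append split: if_splits)

lemma words_SucE:
  assumes "w \<in> words n (Suc k)"
  obtains u i where "w = u @ [i]" "u \<in> words n k" "i \<in> {1..n (Suc k)}"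
proof -
  have "length w = Suc k" using assms by (simp add: words_def)
  then obtain u i where "w = u @ [i]" by (metis length_Suc_conv_rev)
  then show ?thesis using that assms snoc_in_words_iff by metis
qed

lemma length_words: "u \<in> words n k \<Longrightarrow> length u = k"
  by (simp add: words_def)

lemma sum_geometric_subset_le:
  fixes x :: real
  assumes "0 \<le> x" "x < 1" "finite I" "\<And>i. i \<in> I \<Longrightarrow> m \<le> i"
  shows "(\<Sum>i\<in>I. x ^ i) \<le> x ^ m / (1 - x)"
proof -
  have "(\<Sum>i\<in>I. x ^ i) = (\<Sum>j\<in>(\<lambda>i. i - m) ` I. x ^ m * x ^ j)"
    using assms(4) by (subst sum.reindex) (auto simp: inj_on_def eq_diff_iff simp flip: power_add)
  also have "\<dots> = x ^ m * (\<Sum>j\<in>(\<lambda>i. i - m) ` I. x ^ j)" by (simp add: sum_distrib_left)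
  also have "\<dots> \<le> x ^ m * (\<Sum>j. x ^ j)"
    using assms by (intro mult_left_mono sum_le_suminf summable_geometric) auto
  also have "\<dots> = x ^ m / (1 - x)" using assms by (simp add: suminf_geometric)
  finally show ?thesis .
qed

text \<open>Take the least exponent whose power lies below \<open>x\<close>. It is not 0 because
  \<open>x \<le> 1\<close>, so its predecessor is the required index.\<close>

lemma scale_exists:
  fixes x q :: real
  assumes "0 < q" "q < 1" "0 < x" "x \<le> 1"
  obtains i :: nat where "q ^ Suc i < x" "x \<le> q ^ i"
proof -
  obtain p where "q ^ p < x" using real_arch_pow_inv assms by blast
  then have ex: "\<exists>i. q ^ i < x" ..
  define l where "l = (LEAST i. q ^ i < x)"
  have l: "q ^ l < x" unfolding l_def using ex by (rule LeastI_ex)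
  then obtain i where i: "l = Suc i" using assms by (cases l) auto
  have "\<not> q ^ i < x" using not_less_Least[of i "\<lambda>i. q ^ i < x"] i l_def by simp
  then show ?thesis using that[of i] l i by simp
qed

subsection \<open>Geometry of Moran families\<close>

locale moran_family = moran_ratios n c "DIM('a)"
  for n :: "nat \<Rightarrow> nat" and c :: "nat \<Rightarrow> nat \<Rightarrow> real" and J :: "'a::euclidean_space set" +
  fixes F :: "nat list \<Rightarrow> 'a set"
  assumes compact_J: "compact J" and interior_J: "interior J \<noteq> {}"
    and moran_J: "moran_structure J n c F"
begin

text \<open>Membership in the word tree without naming the level, as needed for cut sets that mix
  levels.\<close>

definition valid :: "nat list \<Rightarrow> bool" where "valid u \<longleftrightarrow> u \<in> words n (length u)"

definition ratio :: "nat list \<Rightarrow> real" where "ratio u = diameter (F u) / diameter J"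

text \<open>Some radius of a ball inside \<open>J\<close>, fixed by choice; it is not claimed to be
  the largest.\<close>

definition inradius :: real where "inradius = (SOME a. 0 < a \<and> (\<exists>z. ball z a \<subseteq> J))"

abbreviation "E \<equiv> moran_set n F"

lemma valid_words: "u \<in> words n k \<Longrightarrow> valid u"
  by (simp add: valid_def length_words)

lemma valid_Nil [simp]: "valid []"
  by (simp add: valid_def)

lemma valid_snoc: "valid (u @ [i]) \<longleftrightarrow> valid u \<and> i \<in> {1..n (Suc (length u))}"
  by (simp add: valid_def snoc_in_words_iff)

lemma F_Nil [simp]: "F [] = J"
  using moran_J by (simp add: moran_structure_def)

lemma closed_F: "valid u \<Longrightarrow> closed (F u)"
  and F_similar: "valid u \<Longrightarrow> \<exists>S. similarity S \<and> F u = S ` J"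
  using moran_J by (auto simp: moran_structure_def valid_def)

lemma validD: "valid u \<Longrightarrow> u \<in> words n (length u)"
  by (simp add: valid_def)

lemma valid_prefix: "valid (u @ v) \<Longrightarrow> valid u"
  by (induction v rule: rev_induct) (auto simp: valid_snoc simp flip: append_assoc)

lemma children:
  assumes "valid u"
  shows "\<And>i. i \<in> {1..n (Suc (length u))} \<Longrightarrow> F (u @ [i]) \<subseteq> F u"
    and "disjoint_family_on (\<lambda>i. interior (F (u @ [i]))) {1..n (Suc (length u))}"
    and "\<And>i. i \<in> {1..n (Suc (length u))} \<Longrightarrow>
           diameter (F (u @ [i])) / diameter (F u) = c (Suc (length u)) i"
proof -
  have "\<forall>k\<ge>1. \<forall>u\<in>words n (k - 1).
        (\<forall>i\<in>{1..n k}. F (u @ [i]) \<subseteq> F u) \<and>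
        disjoint_family_on (\<lambda>i. interior (F (u @ [i]))) {1..n k} \<and>
        (\<forall>i\<in>{1..n k}. diameter (F (u @ [i])) / diameter (F u) = c k i)"
    using moran_J unfolding moran_structure_def by (elim conjE)
  from this[rule_format, of "Suc (length u)" u] validD[OF assms]
  show "\<And>i. i \<in> {1..n (Suc (length u))} \<Longrightarrow> F (u @ [i]) \<subseteq> F u"
    "disjoint_family_on (\<lambda>i. interior (F (u @ [i]))) {1..n (Suc (length u))}"
    "\<And>i. i \<in> {1..n (Suc (length u))} \<Longrightarrow>
        diameter (F (u @ [i])) / diameter (F u) = c (Suc (length u)) i"
    by simp_all
qed

lemma F_snoc_subset: "valid (u @ [i]) \<Longrightarrow> F (u @ [i]) \<subseteq> F u"
  by (rule children) (simp_all only: valid_snoc)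

lemma diameter_F_snoc:
  "valid (u @ [i]) \<Longrightarrow> diameter (F (u @ [i])) / diameter (F u) = c (Suc (length u)) i"
  by (rule children) (simp_all only: valid_snoc)

lemma disjoint_snoc:
  assumes "valid (u @ [i])" "valid (u @ [j])" "i \<noteq> j"
  shows "interior (F (u @ [i])) \<inter> interior (F (u @ [j])) = {}"
  using children(2)[of u] assms unfolding valid_snoc disjoint_family_on_def by blast

lemma F_append_subset: "valid (u @ v) \<Longrightarrow> F (u @ v) \<subseteq> F u"
proof (induction v rule: rev_induct)
  case (snoc i v)
  then show ?case
    using F_snoc_subset[of "u @ v" i] valid_snoc[of "u @ v" i] by auto
qed simp

text \<open>Siblings are separated by the Moran structure; words with different parents inherit
  disjointness from the parents.\<close>

lemma interior_disjoint:
  assumes "u \<in> words n k" "v \<in> words n k" "u \<noteq> v"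
  shows "interior (F u) \<inter> interior (F v) = {}"
  using assms
proof (induction k arbitrary: u v)
  case (Suc k)
  obtain u' i where u: "u = u' @ [i]" "u' \<in> words n k" using Suc.prems by (auto elim: words_SucE)
  obtain v' j where v: "v = v' @ [j]" "v' \<in> words n k" using Suc.prems by (auto elim: words_SucE)
  have val: "valid u" "valid v" using Suc.prems by (auto intro: valid_words)
  show ?case
  proof (cases "u' = v'")
    case True
    then show ?thesis using disjoint_snoc Suc.prems(3) u v val by auto
  next
    case False
    then have "interior (F u') \<inter> interior (F v') = {}" using Suc.IH u v by blast
    then show ?thesis
      using F_snoc_subset interior_mono u(1) v(1) val by blast
  qed
qed simp

section \<open>Sizes, inner balls and volume counting\<close>

lemma inradius: "0 < inradius" "\<exists>z. ball z inradius \<subseteq> J"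
proof -
  have "\<exists>a. 0 < a \<and> (\<exists>z. ball z a \<subseteq> J)"
    using interior_J by (metis ex_in_conv mem_interior)
  from someI_ex[OF this] show "0 < inradius" "\<exists>z. ball z inradius \<subseteq> J"
    unfolding inradius_def by auto
qed

lemma J_nonempty: "J \<noteq> {}"
  using interior_J interior_subset by blast

lemma diameter_J_pos: "0 < diameter J"
proof -
  obtain z where "ball z inradius \<subseteq> J" using inradius(2) by blast
  then have "diameter (ball z inradius) \<le> diameter J"
    using compact_J by (intro diameter_subset compact_imp_bounded)
  then show ?thesis using inradius(1) by simp
qed

lemma ratio_Nil [simp]: "ratio [] = 1"
  using diameter_J_pos by (simp add: ratio_def)

lemma ratio_snoc:
  assumes "valid (u @ [i])" shows "ratio (u @ [i]) = c (Suc (length u)) i * ratio u"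
proof -
  have "0 < c (Suc (length u)) i" using assms c_pos by (simp add: valid_snoc)
  \<comment> \<open>Division by 0 yields 0, which would contradict the positive quotient.\<close>
  then have "diameter (F u) \<noteq> 0" using diameter_F_snoc[OF assms] by auto
  then show ?thesis using diameter_F_snoc[OF assms] diameter_J_pos
    by (simp add: ratio_def field_simps)
qed

lemma
  assumes "valid u"
  shows ratio_pos: "0 < ratio u" and ratio_le: "ratio u \<le> cmax ^ length u"
proof -
  have "0 < ratio u \<and> ratio u \<le> cmax ^ length u" using assms
  proof (induction u rule: rev_induct)
    case (snoc i u)
    then have "0 < c (Suc (length u)) i" "c (Suc (length u)) i \<le> cmax"
      using c_pos c_le_cmax by (auto simp: valid_snoc)
    moreover have "0 < ratio u" "ratio u \<le> cmax ^ length u"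
      using snoc by (auto simp: valid_snoc)
    ultimately show ?case using ratio_snoc[OF snoc.prems] by (simp add: mult_mono)
  qed simp
  then show "0 < ratio u" "ratio u \<le> cmax ^ length u" by auto
qed

lemma compact_F: assumes "valid u" shows "compact (F u)"
proof -
  have "F u \<subseteq> J" using F_append_subset[of "[]" u] assms by simp
  then show ?thesis using closed_F[OF assms] compact_J
    by (metis closed_Int_compact inf.absorb1)
qed

lemma F_nonempty: "valid u \<Longrightarrow> F u \<noteq> {}"
  using F_similar J_nonempty by fastforce

lemma dist_F_le:
  assumes "valid u" "x \<in> F u" "y \<in> F u" shows "dist x y \<le> ratio u * diameter J"
proof -
  have "dist x y \<le> diameter (F u)"
    using assms compact_F by (intro diameter_bounded_bound compact_imp_bounded)
  then show ?thesis using diameter_J_pos by (simp add: ratio_def)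
qed

text \<open>The similarity with factor \<open>r\<close> maps a ball in \<open>J\<close> onto one of
  radius \<open>r * inradius\<close> in \<open>F u\<close>, and comparing diameters gives
  \<open>ratio u \<le> r\<close>.\<close>

lemma ball_in_interior_F:
  assumes "valid u"
  shows "\<exists>z. ball z (inradius * ratio u) \<subseteq> interior (F u)"
proof -
  obtain S r where S: "F u = S ` J" "0 < r" "\<And>x y. dist (S x) (S y) = r * dist x y"
    using F_similar[OF assms] unfolding similarity_def by blast
  obtain z where z: "ball z inradius \<subseteq> J" using inradius(2) by blast
  have sub: "ball (S z) (r * inradius) \<subseteq> F u"
    using similarity_ball_image[OF S(2,3), of z inradius] z S(1) by blast
  have "diameter (F u) \<le> r * diameter J"
    unfolding S(1)
  proof (rule diameter_le)
    fix x y assume "x \<in> S ` J" "y \<in> S ` J"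
    then obtain x' y' where "x = S x'" "y = S y'" "x' \<in> J" "y' \<in> J" by auto
    then show "norm (x - y) \<le> r * diameter J"
      using S(2) S(3)[of x' y'] diameter_bounded_bound[OF compact_imp_bounded[OF compact_J], of x' y']
      unfolding dist_norm by simp
  qed (use S(2) diameter_J_pos in auto)
  then have "ratio u \<le> r" using diameter_J_pos by (simp add: ratio_def field_simps)
  then have "ball (S z) (inradius * ratio u) \<subseteq> ball (S z) (r * inradius)"
    using inradius(1) by (intro subset_ball) (simp add: mult.commute)
  then have "ball (S z) (inradius * ratio u) \<subseteq> interior (F u)"
    using sub by (intro interior_maximal) auto
  then show ?thesis by blast
qed

lemma interior_F_nonempty: assumes "valid u" shows "interior (F u) \<noteq> {}"
proof -
  obtain z where "ball z (inradius * ratio u) \<subseteq> interior (F u)"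
    using ball_in_interior_F assms by blast
  moreover have "z \<in> ball z (inradius * ratio u)" using inradius(1) ratio_pos[OF assms] by simp
  ultimately show ?thesis by blast
qed

text \<open>The volume argument behind both bounds: the sets contain disjoint balls of radius
  \<open>inradius * t\<close>, and all of them lie within \<open>r + T * diameter J\<close> of
  \<open>y\<close>.\<close>

lemma card_meeting_ball_le:
  assumes "finite V" "\<And>v. v \<in> V \<Longrightarrow> valid v" "disjoint_family_on (\<lambda>v. interior (F v)) V"
    and "\<And>v. v \<in> V \<Longrightarrow> t \<le> ratio v" "\<And>v. v \<in> V \<Longrightarrow> ratio v \<le> T"
    and "\<And>v. v \<in> V \<Longrightarrow> F v \<inter> ball y r \<noteq> {}" and "0 < t" "0 \<le> T" "0 \<le> r"
  shows "real (card V) \<le> ((r + T * diameter J) / (inradius * t)) ^ DIM('a)"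
proof -
  have "\<exists>z. ball z (inradius * t) \<subseteq> interior (F v)" if v: "v \<in> V" for v
  proof -
    obtain z where "ball z (inradius * ratio v) \<subseteq> interior (F v)"
      using ball_in_interior_F assms(2) v by blast
    moreover have "ball z (inradius * t) \<subseteq> ball z (inradius * ratio v)"
      using inradius(1) assms(4)[OF v] by (intro subset_ball) simp
    ultimately show ?thesis by blast
  qed
  then obtain z where z: "\<And>v. v \<in> V \<Longrightarrow> ball (z v) (inradius * t) \<subseteq> interior (F v)" by metis
  have "real (card V) * (inradius * t) ^ DIM('a) \<le> (r + T * diameter J) ^ DIM('a)"
  proof (rule card_disjoint_balls_le)
    show "disjoint_family_on (\<lambda>v. ball (z v) (inradius * t)) V"
      using assms(3) z unfolding disjoint_family_on_def by blast
    fix v assume v: "v \<in> V"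
    obtain w where w: "w \<in> F v" "dist y w < r" using assms(6)[OF v] by auto
    have "x \<in> ball y (r + T * diameter J)" if "x \<in> F v" for x
    proof -
      have "dist w x \<le> ratio v * diameter J" using dist_F_le[OF assms(2)[OF v]] w that by blast
      also have "\<dots> \<le> T * diameter J"
        using assms(5)[OF v] diameter_J_pos by (intro mult_right_mono) auto
      finally show ?thesis using dist_triangle[of y x w] w by simp
    qed
    then show "ball (z v) (inradius * t) \<subseteq> ball y (r + T * diameter J)"
      using z[OF v] interior_subset by blast
  qed (use assms inradius diameter_J_pos in auto)
  then show ?thesis using assms(7) inradius(1) by (simp add: power_divide field_simps)
qed

section \<open>Points of the Moran set\<close>

lemma E_memD: "x \<in> E \<Longrightarrow> 1 \<le> k \<Longrightarrow> \<exists>u\<in>words n k. x \<in> F u"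
  by (auto simp: moran_set_def)

lemma valid_append_replicate: assumes "valid u" shows "valid (u @ replicate k 1)"
proof (induction k)
  case (Suc k)
  have "valid ((u @ replicate k 1) @ [1])"
    unfolding valid_snoc using Suc n_ge[of "Suc (length (u @ replicate k 1))"] by simp
  then show ?case by (simp add: replicate_append_same)
qed (use assms in simp)

text \<open>Appending ones to \<open>u\<close> gives nested nonempty compact sets; a common point
  lies in sets of all levels and hence in \<open>E\<close>.\<close>

lemma E_meets_F: assumes "valid u" shows "E \<inter> F u \<noteq> {}"
proof -
  define w where "w k = u @ replicate k 1" for k :: nat
  have w: "valid (w k)" for k
    unfolding w_def using assms by (rule valid_append_replicate)
  have mono: "F (w (k + l)) \<subseteq> F (w k)" for k l
    using F_append_subset[of "w k" "replicate l 1"] w[of "k + l"] by (simp add: w_def replicate_add)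
  have "(\<Inter>k. F (w k)) \<noteq> {}"
    using w compact_F F_nonempty
    by (intro compact_nest) (auto simp: le_iff_add dest: subsetD[OF mono])
  then obtain x where x: "\<And>k. x \<in> F (w k)" by auto
  have "x \<in> E" unfolding moran_set_def
  proof
    fix k assume "k \<in> {1::nat..}"
    \<comment> \<open>\<open>w k\<close> has length at least \<open>k\<close>, so its prefix of
      length \<open>k\<close> is a word of level \<open>k\<close>, also for levels above that of
      \<open>u\<close>.\<close>
    have eq: "take k (w k) @ drop k (w k) = w k" by simp
    have v: "valid (take k (w k))" using valid_prefix eq w by metis
    moreover have "length (take k (w k)) = k" by (simp add: w_def)
    ultimately have "take k (w k) \<in> words n k" by (simp add: valid_def)
    moreover have "x \<in> F (take k (w k))"
      using F_append_subset[of "take k (w k)" "drop k (w k)"] w x by auto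
    ultimately show "x \<in> (\<Union>u\<in>words n k. F u)" by blast
  qed
  moreover have "x \<in> F u" using x[of 0] by (simp add: w_def)
  ultimately show ?thesis by blast
qed

subsection \<open>Upper bound\<close>

text \<open>
  A point of \<open>E \<inter> F u\<close> may lie only on the common boundary of \<open>F u\<close> and a neighbouring set, and then in no
  child of \<open>F u\<close>. Asking for infinitely many descendants gives sets that are covered by those of the children.
\<close>

definition cyl :: "nat list \<Rightarrow> 'a set" where
  "cyl u = {x\<in>E. infinite {v. valid (u @ v) \<and> x \<in> F (u @ v)}}"

lemma cyl_subset_E: "cyl u \<subseteq> E"
  by (auto simp: cyl_def)

lemma cyl_subset_F: "cyl u \<subseteq> F u"
proof
  fix x assume "x \<in> cyl u"
  then have "{v. valid (u @ v) \<and> x \<in> F (u @ v)} \<noteq> {}"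
    unfolding cyl_def by (metis (mono_tags, lifting) finite.emptyI mem_Collect_eq)
  then show "x \<in> F u" using F_append_subset by blast
qed

text \<open>A point of \<open>E\<close> lies in a set of every level, so the words containing it
  have unbounded length.\<close>

lemma E_subset_cyl: "E \<subseteq> cyl []"
proof
  fix x assume x: "x \<in> E"
  have "infinite {v. valid v \<and> x \<in> F v}"
  proof
    assume fin: "finite {v. valid v \<and> x \<in> F v}"
    \<comment> \<open>A level beyond all the supposedly finitely many words; \<open>insert 0\<close>
      makes \<open>Max\<close> meaningful for an empty set.\<close>
    define k where "k = Suc (Max (insert 0 (length ` {v. valid v \<and> x \<in> F v})))"
    obtain u where u: "u \<in> words n k" "x \<in> F u" using E_memD[OF x, of k] by (auto simp: k_def)
    then have "length u \<le> Max (insert 0 (length ` {v. valid v \<and> x \<in> F v}))"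
      using fin by (intro Max_ge) (auto intro: valid_words)
    then show False using length_words[OF u(1)] by (simp add: k_def)
  qed
  then show "x \<in> cyl []" using x by (simp add: cyl_def)
qed

text \<open>Pigeonhole: apart from \<open>u\<close> itself, the infinitely many descendants are
  distributed over finitely many children.\<close>

lemma cyl_children: "cyl u \<subseteq> (\<Union>i\<in>{1..n (Suc (length u))}. cyl (u @ [i]))"
proof
  fix x assume x: "x \<in> cyl u"
  define A where "A w = {v. valid (w @ v) \<and> x \<in> F (w @ v)}" for w
  let ?I = "{1..n (Suc (length u))}"
  have "A u \<subseteq> insert [] (\<Union>i\<in>?I. (#) i ` A (u @ [i]))"
  proof
    fix v assume v: "v \<in> A u"
    show "v \<in> insert [] (\<Union>i\<in>?I. (#) i ` A (u @ [i]))"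
    proof (cases v)
      case (Cons i w)
      then have "valid ((u @ [i]) @ w)" "x \<in> F ((u @ [i]) @ w)" using v by (auto simp: A_def)
      then have "w \<in> A (u @ [i])" "i \<in> ?I"
        using valid_prefix[of "u @ [i]" w] by (auto simp: A_def valid_snoc)
      then show ?thesis using Cons by blast
    qed simp
  qed
  moreover have "infinite (A u)" using x by (simp add: cyl_def A_def)
  ultimately have "infinite (\<Union>i\<in>?I. (#) i ` A (u @ [i]))"
    using finite_subset by (metis finite.insertI)
  then obtain i where i: "i \<in> ?I" "infinite (A (u @ [i]))"
    by (meson finite_UN_I finite_atLeastAtMost finite_imageI)
  have "x \<in> E" using x cyl_subset_E by blast
  then have "x \<in> cyl (u @ [i])" using i(2) by (simp add: cyl_def A_def)
  then show "x \<in> (\<Union>i\<in>?I. cyl (u @ [i]))" using i(1) by blast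
qed

text \<open>Descend along each branch until the ratio first drops below \<open>R\<close>. One step
  shrinks it by at least the factor \<open>cs\<close> and no more, so it stays above
  \<open>cs * R\<close>. The hypothesis on \<open>h\<close> says that replacing a word by its
  children does not increase the weighted sum.\<close>

lemma cut_exists:
  assumes h: "\<And>k. (\<Sum>j=1..n (Suc k). c (Suc k) j powr \<alpha>) * h (Suc k) \<le> h k"
    and R: "0 < R" and u: "valid u" "cs * R \<le> ratio u"
  shows "\<exists>V. finite V \<and>
    (\<forall>v\<in>V. valid v \<and> F v \<subseteq> F u \<and> cs * R \<le> ratio v \<and> ratio v < R) \<and>
    disjoint_family_on (\<lambda>v. interior (F v)) V \<and>
    cyl u \<subseteq> (\<Union>v\<in>V. cyl v) \<and>
    (\<Sum>v\<in>V. ratio v powr \<alpha> * h (length v)) \<le> ratio u powr \<alpha> * h (length u)"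
proof -
  define P where "P u V \<longleftrightarrow> finite V \<and>
    (\<forall>v\<in>V. valid v \<and> F v \<subseteq> F u \<and> cs * R \<le> ratio v \<and> ratio v < R) \<and>
    disjoint_family_on (\<lambda>v. interior (F v)) V \<and>
    cyl u \<subseteq> (\<Union>v\<in>V. cyl v) \<and>
    (\<Sum>v\<in>V. ratio v powr \<alpha> * h (length v)) \<le> ratio u powr \<alpha> * h (length u)" for u V
  have small: "P u {u}" if "valid u" "cs * R \<le> ratio u" "ratio u < R" for u
    using that by (auto simp: P_def disjoint_family_on_def)
  \<comment> \<open>\<open>p\<close> bounds the number of levels still to descend, since each level
    contributes a factor of at most \<open>cmax\<close>.\<close>
  have ind: "\<exists>V. P u V" if "valid u" "cs * R \<le> ratio u" "ratio u * cmax ^ p < R" for p u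
    using that
  proof (induction p arbitrary: u)
    case 0
    then show ?case using small[of u] by auto
  next
    case (Suc p)
    show ?case
    proof (cases "ratio u < R")
      case True
      then show ?thesis using small[of u] Suc.prems by blast
    next
      case False
      let ?l = "Suc (length u)"
      let ?I = "{1..n ?l}"
      have ru: "0 < ratio u" using Suc.prems ratio_pos by simp
      have child: "valid (u @ [i])" "ratio (u @ [i]) = c ?l i * ratio u" "cs \<le> c ?l i"
        "c ?l i \<le> cmax" "0 < c ?l i" if "i \<in> ?I" for i
        using that Suc.prems ratio_snoc[of u i] cs_le[of ?l i] c_le_cmax[of ?l i] c_pos[of ?l i]
        by (auto simp: valid_snoc)
      have "\<exists>V. P (u @ [i]) V" if i: "i \<in> ?I" for i
      proof (rule Suc.IH)
        show "valid (u @ [i])" using child i by blast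
        show "cs * R \<le> ratio (u @ [i])"
          using child[OF i] False c_star_pos R by (auto intro!: mult_mono)
        have "ratio (u @ [i]) * cmax ^ p \<le> ratio u * cmax ^ Suc p"
          using child[OF i] ru cmax_bounds
          by (auto simp: algebra_simps intro!: mult_left_mono)
        then show "ratio (u @ [i]) * cmax ^ p < R" using Suc.prems by simp
      qed
      then obtain V where V: "\<And>i. i \<in> ?I \<Longrightarrow> P (u @ [i]) (V i)" by metis
      have sub: "F (u @ [i]) \<subseteq> F u" if "i \<in> ?I" for i
        using F_snoc_subset child that by blast
      have cross: "interior (F v) \<inter> interior (F w) = {}"
        if "i \<in> ?I" "j \<in> ?I" "i \<noteq> j" "v \<in> V i" "w \<in> V j" for i j v w
      proof -
        have "F v \<subseteq> F (u @ [i])" "F w \<subseteq> F (u @ [j])" using V that by (auto simp: P_def)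
        moreover have "interior (F (u @ [i])) \<inter> interior (F (u @ [j])) = {}"
          using disjoint_snoc child that by blast
        ultimately show ?thesis using interior_mono by blast
      qed
      \<comment> \<open>Splitting the sum needs disjoint sets of words: the interior of a common
        word would be disjoint from itself, hence empty.\<close>
      have disj: "V i \<inter> V j = {}" if ij: "i \<in> ?I" "j \<in> ?I" "i \<noteq> j" for i j
      proof -
        have "v \<notin> V j" if v: "v \<in> V i" for v
        proof
          assume "v \<in> V j"
          then have "interior (F v) = {}" using cross[OF ij v, of v] by simp
          moreover have "valid v" using V[OF ij(1)] v by (simp add: P_def)
          ultimately show False using interior_F_nonempty by blast
        qed
        then show ?thesis by blast
      qed
      have "(\<Sum>v\<in>(\<Union>i\<in>?I. V i). ratio v powr \<alpha> * h (length v))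
          = (\<Sum>i\<in>?I. \<Sum>v\<in>V i. ratio v powr \<alpha> * h (length v))"
        using V disj by (intro sum.UNION_disjoint) (auto simp: P_def)
      also have "\<dots> \<le> (\<Sum>i\<in>?I. ratio (u @ [i]) powr \<alpha> * h (length (u @ [i])))"
        using V by (intro sum_mono) (simp add: P_def)
      also have "\<dots> = (\<Sum>i\<in>?I. ratio u powr \<alpha> * (c ?l i powr \<alpha> * h ?l))"
        using child ru by (intro sum.cong) (auto simp: powr_mult)
      also have "\<dots> = ratio u powr \<alpha> * ((\<Sum>i\<in>?I. c ?l i powr \<alpha>) * h ?l)"
        by (simp add: sum_distrib_left sum_distrib_right)
      also have "\<dots> \<le> ratio u powr \<alpha> * h (length u)"
        using h by (intro mult_left_mono) auto
      finally have sum: "(\<Sum>v\<in>(\<Union>i\<in>?I. V i). ratio v powr \<alpha> * h (length v)) \<le> \<dots>" .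
      have dfo: "disjoint_family_on (\<lambda>v. interior (F v)) (\<Union>i\<in>?I. V i)"
        unfolding disjoint_family_on_def
      proof (intro ballI impI)
        fix v w assume "v \<in> (\<Union>i\<in>?I. V i)" "w \<in> (\<Union>i\<in>?I. V i)" and vw: "v \<noteq> w"
        then obtain i j where ij: "i \<in> ?I" "j \<in> ?I" "v \<in> V i" "w \<in> V j" by blast
        show "interior (F v) \<inter> interior (F w) = {}"
        proof (cases "i = j")
          case True
          then show ?thesis using V[of i] ij vw by (auto simp: P_def disjoint_family_on_def)
        next
          case False
          then show ?thesis using cross ij by blast
        qed
      qed
      have cov: "cyl u \<subseteq> (\<Union>v\<in>(\<Union>i\<in>?I. V i). cyl v)"
      proof
        fix x assume "x \<in> cyl u"
        then obtain i where "i \<in> ?I" "x \<in> cyl (u @ [i])" using cyl_children by blast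
        then show "x \<in> (\<Union>v\<in>(\<Union>i\<in>?I. V i). cyl v)" using V[of i] unfolding P_def by blast
      qed
      have "finite (\<Union>i\<in>?I. V i)" using V by (auto simp: P_def)
      moreover have "\<forall>v\<in>(\<Union>i\<in>?I. V i). valid v \<and> F v \<subseteq> F u \<and> cs * R \<le> ratio v \<and> ratio v < R"
        using V sub unfolding P_def by blast
      ultimately have "P u (\<Union>i\<in>?I. V i)"
        using dfo cov sum unfolding P_def by blast
      then show ?thesis ..
    qed
  qed
  have ru: "0 < ratio u" using u ratio_pos by simp
  then obtain p where "cmax ^ p < R / ratio u"
    using real_arch_pow_inv[of "R / ratio u" cmax] cmax_bounds R by auto
  then have "ratio u * cmax ^ p < R" using ru by (simp add: field_simps)
  from ind[OF u this] show ?thesis unfolding P_def .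
qed

text \<open>
  The bound on \<open>Delta\<close> controls full levels only; the weight \<open>h\<close>, a supremum of \<open>Delta\<close> over all
  deeper levels, transfers it to cut sets with words of different lengths.
\<close>

lemma superharmonic_exists:
  assumes "s_star_star n c < \<alpha>"
  obtains h B where "\<And>k. (\<Sum>j=1..n (Suc k). c (Suc k) j powr \<alpha>) * h (Suc k) \<le> h k"
    and "\<And>k. 1 \<le> h k" "\<And>k. h k \<le> B"
proof -
  obtain B where B: "\<And>k m. Delta n c k (k + m) \<alpha> \<le> B" using Delta_bounded[OF assms] by blast
  define h where "h k = (SUP m. Delta n c k (k + m) \<alpha>)" for k
  have bdd: "bdd_above (range (\<lambda>m. Delta n c k (k + m) \<alpha>))" for k
    using B by (auto intro!: bdd_aboveI[of _ B])
  show ?thesis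
  proof
    fix k
    let ?S = "\<Sum>j=1..n (Suc k). c (Suc k) j powr \<alpha>"
    have S: "0 < ?S" by (rule sum_c_pos) simp
    have "h (Suc k) \<le> h k / ?S"
      unfolding h_def[of "Suc k"]
    proof (rule cSUP_least)
      fix m
      \<comment> \<open>Prepending a level turns each term of the supremum at \<open>Suc k\<close>
        into a term of the supremum at \<open>k\<close>.\<close>
      have "?S * Delta n c (Suc k) (Suc k + m) \<alpha> = Delta n c k (k + (1 + m)) \<alpha>"
        using Delta_add[of k 1 m \<alpha>] Delta_Suc[of k 0 \<alpha>] by simp
      also have "\<dots> \<le> h k" unfolding h_def using bdd by (intro cSUP_upper) auto
      finally show "Delta n c (Suc k) (Suc k + m) \<alpha> \<le> h k / ?S" using S by (simp add: field_simps)
    qed simp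
    then show "?S * h (Suc k) \<le> h k" using S by (simp add: field_simps)
    \<comment> \<open>The term \<open>m = 0\<close> is the empty product 1.\<close>
    have "Delta n c k (k + 0) \<alpha> \<le> h k" unfolding h_def using bdd by (intro cSUP_upper) auto
    then show "1 \<le> h k" by simp
    show "h k \<le> B" unfolding h_def using B by (intro cSUP_least) auto
  qed
qed

text \<open>Cut below \<open>u\<close> at size \<open>r\<close>. Since \<open>h\<close> lies between
  1 and \<open>B\<close>, the weighted sum bounds the number of pieces, and each piece that matters
  gets one centre.\<close>

lemma cyl_cover:
  assumes \<alpha>: "0 \<le> \<alpha>"
    and h: "\<And>k. (\<Sum>j=1..n (Suc k). c (Suc k) j powr \<alpha>) * h (Suc k) \<le> h k"
      "\<And>k. 1 \<le> h k" "\<And>k. h k \<le> B"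
    and r: "0 < r" and u: "valid u" "cs * r \<le> ratio u"
  shows "\<exists>C\<subseteq>E. finite C \<and> real (card C) \<le> B * (ratio u / (cs * r)) powr \<alpha> \<and>
           cyl u \<subseteq> (\<Union>y\<in>C. ball y (r * diameter J))"
proof -
  obtain V where V: "finite V" "\<And>v. v \<in> V \<Longrightarrow> valid v \<and> cs * r \<le> ratio v \<and> ratio v < r"
    "cyl u \<subseteq> (\<Union>v\<in>V. cyl v)"
    "(\<Sum>v\<in>V. ratio v powr \<alpha> * h (length v)) \<le> ratio u powr \<alpha> * h (length u)"
    using cut_exists[where h=h and \<alpha>=\<alpha>, OF h(1) r u] by blast
  \<comment> \<open>Only these pieces supply a centre, since centres have to be points of
    \<open>E\<close>.\<close>
  define V' where "V' = {v\<in>V. cyl v \<noteq> {}}"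
  define e where "e v = (SOME x. x \<in> cyl v)" for v
  have e: "e v \<in> cyl v" if "v \<in> V'" for v
    using that unfolding e_def V'_def by (auto intro: someI_ex)
  have pos: "0 < cs * r" using c_star_pos r by simp
  have "real (card V) * (cs * r) powr \<alpha> = (\<Sum>v\<in>V. (cs * r) powr \<alpha> * 1)" by simp
  also have "\<dots> \<le> (\<Sum>v\<in>V. ratio v powr \<alpha> * h (length v))"
    using V(2) pos \<alpha> h(2) by (intro sum_mono mult_mono powr_mono2) auto
  also have "\<dots> \<le> B * ratio u powr \<alpha>"
    using V(4) h(3)[of "length u"] by (smt (verit) mult.commute mult_left_mono powr_ge_zero)
  finally have "real (card V) \<le> B * ratio u powr \<alpha> / (cs * r) powr \<alpha>"
    by (subst pos_le_divide_eq) (use pos in auto)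
  then have "real (card V) \<le> B * (ratio u / (cs * r)) powr \<alpha>"
    using pos ratio_pos[OF u(1)] by (simp add: powr_divide)
  moreover have "card (e ` V') \<le> card V'" using V(1) by (intro card_image_le) (simp add: V'_def)
  moreover have "card V' \<le> card V" using V(1) by (intro card_mono) (auto simp: V'_def)
  ultimately have "real (card (e ` V')) \<le> B * (ratio u / (cs * r)) powr \<alpha>" by linarith
  moreover have "cyl u \<subseteq> (\<Union>y\<in>e ` V'. ball y (r * diameter J))"
  proof
    fix x assume "x \<in> cyl u"
    then obtain v where v: "v \<in> V" "x \<in> cyl v" using V(3) by blast
    then have v': "v \<in> V'" by (auto simp: V'_def)
    have "dist (e v) x \<le> ratio v * diameter J"
      using V(2)[OF v(1)] e[OF v'] v(2) cyl_subset_F by (intro dist_F_le) auto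
    also have "\<dots> < r * diameter J" using V(2)[OF v(1)] diameter_J_pos by simp
    finally show "x \<in> (\<Union>y\<in>e ` V'. ball y (r * diameter J))" using v' by auto
  qed
  moreover have "e ` V' \<subseteq> E" using e cyl_subset_E by blast
  moreover have "finite (e ` V')" using V(1) by (simp add: V'_def)
  ultimately show ?thesis by blast
qed

text \<open>Two cuts: \<open>J\<close> is cut at size \<open>R\<close>, volume comparison bounds the
  pieces that meet the ball, and \<open>cyl_cover\<close> handles each of them at the finer
  size.\<close>

lemma cover_num_upper:
  assumes "s_star_star n c < \<alpha>"
  shows "\<exists>b>0. \<exists>K>0. \<forall>r R. 0 < r \<and> r < R \<and> R < b \<longrightarrow>
           ereal_of_enat (cover_num r R E) \<le> ereal (K * (R / r) powr \<alpha>)"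
proof -
  have \<alpha>: "0 \<le> \<alpha>" using assms s_star_star_nonneg by simp
  obtain h B where h: "\<And>k. (\<Sum>j=1..n (Suc k). c (Suc k) j powr \<alpha>) * h (Suc k) \<le> h k"
    "\<And>k. 1 \<le> h k" "\<And>k. h k \<le> B"
    using superharmonic_exists[OF assms] by blast
  \<comment> \<open>Pieces of ratio below \<open>r / D\<close> have diameter below \<open>r\<close>,
    and \<open>R + R * diameter J = R * D\<close>.\<close>
  define D where "D = diameter J + 1"
  have D: "1 \<le> D" "diameter J \<le> D" using diameter_J_pos by (auto simp: D_def)
  have B: "1 \<le> B" using h(2)[of 0] h(3)[of 0] by simp
  define C1 where "C1 = (D / (inradius * cs)) ^ DIM('a)"
  have C1: "0 < C1" unfolding C1_def using D inradius(1) c_star_pos by simp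
  define K where "K = C1 * (B * (D / cs) powr \<alpha>)"
  have K: "0 < K" unfolding K_def using C1 B D c_star_pos by simp
  have "ereal_of_enat (cover_num r R E) \<le> ereal (K * (R / r) powr \<alpha>)"
    if r: "0 < r" "r < R" "R < 1" for r R
  proof (rule cover_num_leI)
    show "0 \<le> K * (R / r) powr \<alpha>" using K by simp
    fix x assume "x \<in> E"
    \<comment> \<open>The root can be cut at size \<open>R\<close> because
      \<open>cs \<le> cmax < 1\<close> and \<open>R < 1\<close>; hence the choice
      \<open>b = 1\<close>.\<close>
    have "cs * R \<le> ratio []"
      using cs_le[of 1 1] c_le_cmax[of 1 1] cmax_bounds n_ge[of 1] r c_star_pos
      by (simp add: mult_le_one)
    then obtain V where V: "finite V" "\<And>v. v \<in> V \<Longrightarrow> valid v \<and> cs * R \<le> ratio v \<and> ratio v < R"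
      "disjoint_family_on (\<lambda>v. interior (F v)) V" "cyl [] \<subseteq> (\<Union>v\<in>V. cyl v)"
      using cut_exists[where h=h and \<alpha>=\<alpha>, OF h(1), of R "[]"] r by auto
    define V' where "V' = {v\<in>V. F v \<inter> ball x R \<noteq> {}}"
    have V': "finite V'" "V' \<subseteq> V" using V(1) by (auto simp: V'_def)
    have "real (card V') \<le> ((R + R * diameter J) / (inradius * (cs * R))) ^ DIM('a)"
    proof (rule card_meeting_ball_le)
      show "disjoint_family_on (\<lambda>v. interior (F v)) V'"
        using V(3) V'(2) by (auto simp: disjoint_family_on_def)
    qed (use V V' V'_def r c_star_pos in \<open>auto dest!: V(2)\<close>)
    also have "R + R * diameter J = R * D" by (simp add: D_def algebra_simps)
    also have "R * D / (inradius * (cs * R)) = D / (inradius * cs)" using r by simp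
    finally have card: "real (card V') \<le> C1" by (simp add: C1_def)
    let ?M = "B * (D / cs * (R / r)) powr \<alpha>"
    have "\<exists>C\<subseteq>E. finite C \<and> real (card C) \<le> ?M \<and> cyl v \<subseteq> (\<Union>y\<in>C. ball y r)" if v: "v \<in> V'" for v
    proof -
      have v': "valid v" "cs * R \<le> ratio v" "ratio v \<le> R" using V(2)[of v] V'(2) v by auto
      have rD: "r / D \<le> r" using r D by (simp add: field_simps)
      then have "cs * (r / D) \<le> cs * R" using r c_star_pos by (intro mult_left_mono) auto
      then have "cs * (r / D) \<le> ratio v" using v'(2) by linarith
      then obtain C where C: "C \<subseteq> E" "finite C"
        "real (card C) \<le> B * (ratio v / (cs * (r / D))) powr \<alpha>"
        "cyl v \<subseteq> (\<Union>y\<in>C. ball y (r / D * diameter J))"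
        using cyl_cover[where h=h and \<alpha>=\<alpha>, OF \<alpha> h, of "r / D" v] r D v' by auto
      have "ratio v / (cs * (r / D)) \<le> R / (cs * (r / D))"
        using v' r D c_star_pos by (intro divide_right_mono) auto
      also have "\<dots> = D / cs * (R / r)" by (simp add: field_simps)
      finally have "(ratio v / (cs * (r / D))) powr \<alpha> \<le> (D / cs * (R / r)) powr \<alpha>"
        using \<alpha> ratio_pos[OF v'(1)] r D c_star_pos by (intro powr_mono2) auto
      then have "B * (ratio v / (cs * (r / D))) powr \<alpha> \<le> ?M"
        using B by (intro mult_left_mono) auto
      moreover have "r / D * diameter J \<le> r" using r D by (simp add: field_simps)
      then have "ball y (r / D * diameter J) \<subseteq> ball y r" for y :: 'a by (rule subset_ball)
      then have "cyl v \<subseteq> (\<Union>y\<in>C. ball y r)" using C(4) by blast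
      ultimately show ?thesis using C by (intro exI[of _ C]) auto
    qed
    then obtain C where C: "\<And>v. v \<in> V' \<Longrightarrow> C v \<subseteq> E \<and> finite (C v) \<and> real (card (C v)) \<le> ?M \<and>
        cyl v \<subseteq> (\<Union>y\<in>C v. ball y r)" by metis
    show "\<exists>C\<subseteq>E. finite C \<and> real (card C) \<le> K * (R / r) powr \<alpha> \<and> E \<inter> ball x R \<subseteq> (\<Union>y\<in>C. ball y r)"
    proof (intro exI[of _ "\<Union>v\<in>V'. C v"] conjI)
      show "(\<Union>v\<in>V'. C v) \<subseteq> E" "finite (\<Union>v\<in>V'. C v)" using C V'(1) by auto
      have "real (card (\<Union>v\<in>V'. C v)) \<le> (\<Sum>v\<in>V'. real (card (C v)))"
        using card_UN_le[OF V'(1), of C] by (metis of_nat_mono of_nat_sum)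
      also have "\<dots> \<le> real (card V') * ?M" using C by (intro sum_bounded_above) blast
      also have "\<dots> \<le> C1 * ?M" using card B by (intro mult_right_mono) auto
      also have "\<dots> = K * (R / r) powr \<alpha>"
        unfolding K_def using D r c_star_pos by (subst powr_mult) auto
      finally show "real (card (\<Union>v\<in>V'. C v)) \<le> K * (R / r) powr \<alpha>" .
      show "E \<inter> ball x R \<subseteq> (\<Union>y\<in>\<Union>v\<in>V'. C v. ball y r)"
      proof
        fix y assume y: "y \<in> E \<inter> ball x R"
        then obtain v where v: "v \<in> V" "y \<in> cyl v" using V(4) E_subset_cyl by blast
        then have "v \<in> V'" using y cyl_subset_F unfolding V'_def by blast
        then show "y \<in> (\<Union>y\<in>\<Union>v\<in>V'. C v. ball y r)" using C v by blast
      qed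
    qed
  qed
  then show ?thesis using K by (intro exI[of _ "1::real"] exI[of _ K]) auto
qed

subsection \<open>Lower bound\<close>

text \<open>The level \<open>m\<close> below \<open>u\<close>, built by appending all letters.
  Ratios multiply along words, so the sum of powers factors into the level sums of
  \<open>Delta\<close>.\<close>

lemma descendants_exist:
  assumes "valid u"
  shows "\<exists>V. finite V \<and> V \<subseteq> words n (length u + m) \<and>
    (\<forall>v\<in>V. F v \<subseteq> F u \<and> ratio v \<le> cmax ^ m * ratio u) \<and>
    (\<Sum>v\<in>V. ratio v powr s) = ratio u powr s * Delta n c (length u) (length u + m) s"
proof (induction m)
  case 0
  then show ?case using validD[OF assms] by (intro exI[of _ "{u}"]) auto
next
  case (Suc m)
  let ?l = "length u + m"
  let ?I = "{1..n (Suc ?l)}"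
  let ?f = "\<lambda>(v, i). v @ [i]"
  obtain V where V: "finite V" "V \<subseteq> words n ?l"
    "\<And>v. v \<in> V \<Longrightarrow> F v \<subseteq> F u \<and> ratio v \<le> cmax ^ m * ratio u"
    "(\<Sum>v\<in>V. ratio v powr s) = ratio u powr s * Delta n c (length u) ?l s"
    using Suc.IH by blast
  have child: "length v = ?l" "v @ [i] \<in> words n (Suc ?l)" "valid (v @ [i])"
    "ratio (v @ [i]) = c (Suc ?l) i * ratio v" "0 < c (Suc ?l) i" "c (Suc ?l) i \<le> cmax"
    "0 < ratio v" if "v \<in> V" "i \<in> ?I" for v i
  proof -
    have v: "v \<in> words n ?l" "valid v" using V(2) that by (auto intro: valid_words)
    then show "length v = ?l" by (simp add: length_words)
    show "v @ [i] \<in> words n (Suc ?l)" using v that by (simp add: snoc_in_words_iff)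
    then show "valid (v @ [i])" by (rule valid_words)
    then show "ratio (v @ [i]) = c (Suc ?l) i * ratio v"
      using ratio_snoc \<open>length v = ?l\<close> by metis
    show "0 < c (Suc ?l) i" "c (Suc ?l) i \<le> cmax" "0 < ratio v"
      using that c_pos c_le_cmax ratio_pos v by auto
  qed
  have "(\<Sum>v\<in>?f ` (V \<times> ?I). ratio v powr s) = (\<Sum>p\<in>V \<times> ?I. ratio (?f p) powr s)"
    by (subst sum.reindex) (auto simp: inj_on_def)
  also have "\<dots> = (\<Sum>p\<in>V \<times> ?I. case p of (v, i) \<Rightarrow> ratio v powr s * c (Suc ?l) i powr s)"
    using child by (intro sum.cong refl) (force simp: powr_mult)
  also have "\<dots> = (\<Sum>v\<in>V. ratio v powr s) * (\<Sum>i\<in>?I. c (Suc ?l) i powr s)"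
    by (simp add: sum_product sum.cartesian_product)
  also have "\<dots> = ratio u powr s * Delta n c (length u) (length u + Suc m) s"
    using V(4) by (simp add: Delta_Suc del: add_Suc_right) (simp add: add_Suc_right)
  finally have sum: "(\<Sum>v\<in>?f ` (V \<times> ?I). ratio v powr s) = \<dots>" .
  have "F (v @ [i]) \<subseteq> F u \<and> ratio (v @ [i]) \<le> cmax ^ Suc m * ratio u"
    if vi: "v \<in> V" "i \<in> ?I" for v i
  proof
    show "F (v @ [i]) \<subseteq> F u" using F_snoc_subset[of v i] child[OF vi] V(3)[OF vi(1)] by blast
    have "c (Suc ?l) i * ratio v \<le> cmax * (cmax ^ m * ratio u)"
      using child[OF vi] V(3)[OF vi(1)] cmax_bounds by (intro mult_mono) auto
    then show "ratio (v @ [i]) \<le> cmax ^ Suc m * ratio u" using child[OF vi] by simp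
  qed
  moreover have "?f ` (V \<times> ?I) \<subseteq> words n (length u + Suc m)" using child(2) by auto
  moreover have "finite (?f ` (V \<times> ?I))" using V(1) by simp
  ultimately show ?case using sum by (intro exI[of _ "?f ` (V \<times> ?I)"]) auto
qed

text \<open>Each set contains a point of \<open>E\<close>. These points lie in one ball of size
  about \<open>F u\<close>, which is covered by few balls of the size of the sets, and each such
  ball meets boundedly many of the sets by volume comparison.\<close>

lemma card_same_scale_le:
  assumes cov: "\<And>r R. 0 < r \<Longrightarrow> r < R \<Longrightarrow> R < b \<Longrightarrow>
      ereal_of_enat (cover_num r R E) \<le> ereal (K * (R / r) powr \<alpha>)"
    and u: "2 * diameter J * ratio u < b" "valid u"
    and V: "finite V" "\<And>v. v \<in> V \<Longrightarrow> valid v \<and> F v \<subseteq> F u"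
      "disjoint_family_on (\<lambda>v. interior (F v)) V"
    and t: "0 < t" "t \<le> 1" and \<theta>: "0 < \<theta>" "\<theta> < 1"
    and scale: "\<And>v. v \<in> V \<Longrightarrow> ratio u * t * \<theta> \<le> ratio v \<and> ratio v \<le> ratio u * t"
  shows "real (card V) \<le> K * (2 / \<theta>) powr \<alpha> * (diameter J * (\<theta> + 1) / (inradius * \<theta>)) ^ DIM('a)
           * t powr - \<alpha>"
proof -
  define G where "G = (diameter J * (\<theta> + 1) / (inradius * \<theta>)) ^ DIM('a)"
  have G: "0 \<le> G" unfolding G_def using diameter_J_pos inradius(1) \<theta> by simp
  have ru: "0 < ratio u" using u ratio_pos by simp
  \<comment> \<open>\<open>r\<close> is the lower bound on the diameters of the sets; the factor 2
    in \<open>R\<close> makes an open ball about a point of \<open>F u\<close> contain all of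
    \<open>F u\<close>.\<close>
  define r where "r = diameter J * ratio u * t * \<theta>"
  define R where "R = 2 * diameter J * ratio u"
  have r: "0 < r" unfolding r_def using diameter_J_pos ru t \<theta> by simp
  have "t * \<theta> < 2" using mult_mono[of t 1 \<theta> 1] t \<theta> by simp
  then have "diameter J * ratio u * (t * \<theta>) < diameter J * ratio u * 2"
    using diameter_J_pos ru by (intro mult_strict_left_mono) auto
  then have rR: "r < R" by (simp add: r_def R_def mult_ac)
  define e where "e v = (SOME x. x \<in> E \<inter> F v)" for v
  have e: "e v \<in> E" "e v \<in> F v" if "valid v" for v
    using E_meets_F[OF that] someI_ex[of "\<lambda>x. x \<in> E \<inter> F v"] unfolding e_def by blast+
  obtain C where C: "C \<subseteq> E" "finite C" "real (card C) \<le> K * (R / r) powr \<alpha>"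
    "E \<inter> ball (e u) R \<subseteq> (\<Union>y\<in>C. ball y r)"
    using cover_num_leD[OF cov[OF r rR] e(1)[OF u(2)]] u(1) unfolding R_def by blast
  \<comment> \<open>The sets are grouped by the covering balls that contain their chosen
    points.\<close>
  define V' where "V' y = {v\<in>V. e v \<in> ball y r}" for y
  have "V \<subseteq> (\<Union>y\<in>C. V' y)"
  proof
    fix v assume v: "v \<in> V"
    have "dist (e u) (e v) \<le> ratio u * diameter J"
      using u e V(2)[OF v] by (intro dist_F_le) auto
    also have "\<dots> < R" unfolding R_def using diameter_J_pos ru by simp
    finally have "e v \<in> E \<inter> ball (e u) R" using e V(2)[OF v] by simp
    then show "v \<in> (\<Union>y\<in>C. V' y)" using C(4) v unfolding V'_def by blast
  qed
  then have "real (card V) \<le> real (card (\<Union>y\<in>C. V' y))"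
    using C(2) V(1) by (intro of_nat_mono card_mono) (auto simp: V'_def)
  also have "\<dots> \<le> (\<Sum>y\<in>C. real (card (V' y)))"
    using card_UN_le[OF C(2), of V'] by (metis of_nat_mono of_nat_sum)
  also have "\<dots> \<le> (\<Sum>y\<in>C. G)"
  proof (rule sum_mono)
    fix y
    have "real (card (V' y)) \<le> ((r + ratio u * t * diameter J) / (inradius * (ratio u * t * \<theta>))) ^ DIM('a)"
    proof (rule card_meeting_ball_le)
      show "disjoint_family_on (\<lambda>v. interior (F v)) (V' y)"
        using V(3) by (auto simp: V'_def disjoint_family_on_def)
      fix v assume "v \<in> V' y"
      then have "e v \<in> F v \<inter> ball y r" using e V(2) by (auto simp: V'_def)
      then show "F v \<inter> ball y r \<noteq> {}" by blast
    qed (use V scale ru t \<theta> r in \<open>auto simp: V'_def\<close>)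
    also have "r + ratio u * t * diameter J = ratio u * t * (diameter J * (\<theta> + 1))"
      by (simp add: r_def algebra_simps)
    also have "ratio u * t * (diameter J * (\<theta> + 1)) / (inradius * (ratio u * t * \<theta>))
        = diameter J * (\<theta> + 1) / (inradius * \<theta>)"
      using ru t by simp
    finally show "real (card (V' y)) \<le> G" by (simp add: G_def)
  qed
  also have "\<dots> = real (card C) * G" by simp
  also have "\<dots> \<le> K * (R / r) powr \<alpha> * G" using C(3) G by (rule mult_right_mono)
  also have "R / r = 2 / \<theta> * (1 / t)"
    unfolding R_def r_def using diameter_J_pos ru by simp
  also have "(2 / \<theta> * (1 / t)) powr \<alpha> = (2 / \<theta>) powr \<alpha> * t powr - \<alpha>"
    using t \<theta> by (simp add: powr_mult powr_minus powr_divide field_simps)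
  finally show ?thesis by (simp add: G_def mult_ac)
qed

lemma s_star_star_le_of_cover:
  assumes cov: "\<And>r R. 0 < r \<Longrightarrow> r < R \<Longrightarrow> R < b \<Longrightarrow>
      ereal_of_enat (cover_num r R E) \<le> ereal (K * (R / r) powr \<alpha>)"
    and "0 < b" "0 < K" "0 \<le> \<alpha>" "\<alpha> < s"
  shows "s_star_star n c \<le> s"
proof -
  let ?q = cmax
  define M where "M = K * (2 / ?q) powr \<alpha> * (diameter J * (?q + 1) / (inradius * ?q)) ^ DIM('a)"
  have M: "0 \<le> M" unfolding M_def using assms diameter_J_pos inradius(1) cmax_bounds by simp
  \<comment> \<open>Words of relative size about \<open>?q ^ i\<close> number at most
    \<open>M * (?q ^ i) powr - \<alpha>\<close> and weigh at most \<open>(?q ^ i) powr s\<close>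
    each, together \<open>M * x ^ i\<close>.\<close>
  define x where "x = ?q powr (s - \<alpha>)"
  have x: "0 < x" "x < 1" unfolding x_def using cmax_bounds cmax_powr_less_1[of "s - \<alpha>"] assms by auto
  \<comment> \<open>From level \<open>k0\<close> on, the sets are small enough for the covering
    bound, which holds only for radii below \<open>b\<close>.\<close>
  obtain k0 where k0: "?q ^ k0 < b / (2 * diameter J)"
    using real_arch_pow_inv[of "b / (2 * diameter J)" ?q] cmax_bounds assms diameter_J_pos by auto
  have key: "Delta n c k (k + m) s \<le> M * (x ^ m / (1 - x))" if k: "k0 \<le> k" for k m
  proof -
    obtain u where u: "length u = k" "valid u"
      using valid_append_replicate[OF valid_Nil, of k] that[of "replicate k 1"] by simp
    have ru: "0 < ratio u" using ratio_pos u by simp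
    have "ratio u \<le> ?q ^ k" using ratio_le[OF u(2)] u(1) by simp
    also have "\<dots> \<le> ?q ^ k0" using k cmax_bounds by (intro power_decreasing) auto
    finally have "ratio u < b / (2 * diameter J)" using k0 by simp
    then have small: "2 * diameter J * ratio u < b" using diameter_J_pos by (simp add: field_simps)
    obtain V where V: "finite V" "V \<subseteq> words n (k + m)"
      "\<And>v. v \<in> V \<Longrightarrow> F v \<subseteq> F u \<and> ratio v \<le> ?q ^ m * ratio u"
      "(\<Sum>v\<in>V. ratio v powr s) = ratio u powr s * Delta n c k (k + m) s"
      using descendants_exist[OF u(2), of m s] u(1) by blast
    have val: "valid v" if "v \<in> V" for v using V(2) that by (auto intro: valid_words)
    have "\<exists>i. ?q ^ Suc i < ratio v / ratio u \<and> ratio v / ratio u \<le> ?q ^ i" if "v \<in> V" for v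
    proof -
      have "ratio v \<le> ?q ^ m * ratio u" using V(3)[OF that] by blast
      also have "\<dots> \<le> 1 * ratio u"
        using ru cmax_bounds by (intro mult_right_mono power_le_one) auto
      finally have "0 < ratio v / ratio u" "ratio v / ratio u \<le> 1"
        using ru ratio_pos[OF val[OF that]] by auto
      then show ?thesis
        using scale_exists[OF cmax_bounds] by metis
    qed
    then obtain g where g: "\<And>v. v \<in> V \<Longrightarrow> ?q ^ Suc (g v) < ratio v / ratio u \<and> ratio v / ratio u \<le> ?q ^ g v"
      by metis
    \<comment> \<open>This restricts the geometric series to its tail, the source of smallness in
      \<open>m\<close>.\<close>
    have g_ge: "m \<le> i" if i: "i \<in> g ` V" for i
    proof -
      obtain v where v: "v \<in> V" "i = g v" using i by blast
      have "ratio v / ratio u \<le> ?q ^ m" using V(3)[OF v(1)] ru by (simp add: field_simps)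
      then have "?q ^ Suc i < ?q ^ m" using g[OF v(1)] unfolding v(2) by linarith
      then have "m < Suc i" using cmax_bounds power_strict_decreasing_iff by blast
      then show ?thesis by simp
    qed
    have "Delta n c k (k + m) s = (\<Sum>v\<in>V. (ratio v / ratio u) powr s)"
    proof -
      have "(\<Sum>v\<in>V. (ratio v / ratio u) powr s) = (\<Sum>v\<in>V. ratio v powr s / ratio u powr s)"
        by (simp only: powr_divide)
      also have "\<dots> = Delta n c k (k + m) s"
        using V(4) ru by (simp flip: sum_divide_distrib)
      finally show ?thesis ..
    qed
    also have "\<dots> = (\<Sum>i\<in>g ` V. \<Sum>v\<in>{v\<in>V. g v = i}. (ratio v / ratio u) powr s)"
      using V(1) by (rule sum.image_gen)
    also have "\<dots> \<le> (\<Sum>i\<in>g ` V. M * x ^ i)"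
    proof (rule sum_mono)
      fix i
      let ?W = "{v\<in>V. g v = i}"
      have pw: "(?q ^ i) powr y = (?q powr y) ^ i" for y
        using cmax_bounds by (simp add: powr_realpow[symmetric] powr_powr mult.commute)
      have "(\<Sum>v\<in>?W. (ratio v / ratio u) powr s) \<le> real (card ?W) * (?q ^ i) powr s"
        using g val ru ratio_pos assms(4,5)
        by (intro sum_bounded_above powr_mono2) (auto simp: less_imp_le)
      also have "\<dots> \<le> (M * (?q ^ i) powr - \<alpha>) * (?q ^ i) powr s"
      proof (rule mult_right_mono)
        show "real (card ?W) \<le> M * (?q ^ i) powr - \<alpha>"
          unfolding M_def
        \<comment> \<open>Here \<open>t\<close> is \<open>?q ^ i\<close> and \<theta> is
          \<open>?q\<close>.\<close>
        proof (rule card_same_scale_le[OF cov small u(2)])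
          show "disjoint_family_on (\<lambda>v. interior (F v)) ?W"
            using interior_disjoint V(2) unfolding disjoint_family_on_def by blast
          show "ratio u * ?q ^ i * ?q \<le> ratio v \<and> ratio v \<le> ratio u * ?q ^ i" if "v \<in> ?W" for v
            using g[of v] that ru by (auto simp: field_simps)
        qed (use V val cmax_bounds in \<open>auto intro: power_le_one\<close>)
      qed simp
      also have "\<dots> = M * x ^ i"
        unfolding x_def pw mult.assoc power_mult_distrib[symmetric] powr_add[symmetric] by simp
      finally show "(\<Sum>v\<in>?W. (ratio v / ratio u) powr s) \<le> M * x ^ i" .
    qed
    also have "\<dots> = M * (\<Sum>i\<in>g ` V. x ^ i)" by (simp add: sum_distrib_left)
    also have "\<dots> \<le> M * (x ^ m / (1 - x))"
      using M x V(1) g_ge by (intro mult_left_mono sum_geometric_subset_le) auto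
    finally show ?thesis .
  qed
  \<comment> \<open>For arbitrary \<open>k\<close>, the first \<open>k0\<close> levels cost at most
    \<open>nmax ^ k0\<close>, and \<open>key\<close> applies to the rest, which starts at level
    \<open>k + k0\<close>. Adding 1 makes \<open>A\<close> positive.\<close>
  define A where "A = nmax ^ k0 * (M / (1 - x)) + 1"
  have "0 \<le> nmax ^ k0 * (M / (1 - x))" using M x nmax_ge1 by simp
  then have A: "0 < A" by (simp add: A_def)
  obtain m where m: "x ^ m < 1 / A" using real_arch_pow_inv[of "1 / A" x] x A by auto
  have m': "x ^ Suc m \<le> 1 / A"
    using m x mult_mono[of x 1 "x ^ m" "1 / A"] by simp
  show ?thesis
  proof (rule s_star_star_le)
    show "0 < k0 + Suc m" by simp
    fix k
    have "Delta n c k (k + (k0 + Suc m)) s = Delta n c k (k + k0) s * Delta n c (k + k0) (k + k0 + Suc m) s"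
      by (rule Delta_add)
    also have "\<dots> \<le> nmax ^ k0 * (M * (x ^ Suc m / (1 - x)))"
      using assms(4,5) nmax_ge1 Delta_pos[of "k + k0" "Suc m" s]
      by (intro mult_mono Delta_le_nmax key) auto
    also have "\<dots> = (A - 1) * x ^ Suc m" by (simp add: A_def)
    also have "\<dots> \<le> A * (1 / A)" using m' x A by (intro mult_mono) auto
    also have "\<dots> = 1" using A by simp
    finally show "Delta n c k (k + (k0 + Suc m)) s \<le> 1" .
  qed
qed

lemma assouad_dim_moran_set: "assouad_dim E = ereal (s_star_star n c)"
proof (rule antisym)
  let ?A = "{ereal \<alpha> | \<alpha>. 0 \<le> \<alpha> \<and>
            (\<exists>b>0. \<exists>c>0. \<forall>r R. 0 < r \<and> r < R \<and> R < b \<longrightarrow>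
               ereal_of_enat (cover_num r R E) \<le> ereal (c * (R / r) powr \<alpha>))}"
  \<comment> \<open>The upper bound is available only for exponents strictly above the limit, so a
    positive \<open>e\<close> is added and then removed.\<close>
  have "Inf ?A \<le> ereal (s_star_star n c) + ereal e" if "0 < e" for e
  proof (rule Inf_lower2)
    have "\<exists>b>0. \<exists>K>0. \<forall>r R. 0 < r \<and> r < R \<and> R < b \<longrightarrow>
        ereal_of_enat (cover_num r R E) \<le> ereal (K * (R / r) powr (s_star_star n c + e))"
      by (rule cover_num_upper) (use \<open>0 < e\<close> in simp)
    moreover have "0 \<le> s_star_star n c + e" using s_star_star_nonneg \<open>0 < e\<close> by simp
    ultimately show "ereal (s_star_star n c + e) \<in> ?A" by blast
  qed simp
  then have "Inf ?A \<le> ereal (s_star_star n c)"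
    by (rule ereal_le_epsilon2[rule_format])
  then show "assouad_dim E \<le> ereal (s_star_star n c)"
    by (simp only: assouad_dim_def)
  show "ereal (s_star_star n c) \<le> assouad_dim E"
    unfolding assouad_dim_def
  proof (rule Inf_greatest)
    fix z assume "z \<in> ?A"
    then obtain \<alpha> b K where z: "z = ereal \<alpha>" "0 \<le> \<alpha>" "0 < b" "0 < K"
      and cov: "\<forall>r R. 0 < r \<and> r < R \<and> R < b \<longrightarrow>
        ereal_of_enat (cover_num r R E) \<le> ereal (K * (R / r) powr \<alpha>)" by blast
    have "s_star_star n c \<le> \<alpha>"
    proof (rule dense_ge)
      fix s assume "\<alpha> < s"
      then show "s_star_star n c \<le> s"
        by (intro s_star_star_le_of_cover[OF cov[rule_format] z(3,4,2)]) auto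
    qed
    then show "ereal (s_star_star n c) \<le> z" using z(1) by simp
  qed
qed

end

text \<open>Convergence belongs to the conclusion because \<open>lim\<close> of a divergent sequence
  is an unspecified value.\<close>

theorem theorem1:
  fixes J :: "'a::euclidean_space set"
    and n :: "nat \<Rightarrow> nat"
    and c :: "nat \<Rightarrow> nat \<Rightarrow> real"
    and E :: "'a set"
  assumes "compact J" and "interior J \<noteq> {}"
    and "\<And>k. 1 \<le> k \<Longrightarrow> 2 \<le> n k"
    and "\<And>k j. 1 \<le> k \<Longrightarrow> 1 \<le> j \<Longrightarrow> j \<le> n k \<Longrightarrow> 0 < c k j"
    and "\<And>k. 1 \<le> k \<Longrightarrow> (\<Sum>j=1..n k. c k j ^ DIM('a)) \<le> 1"
    and "0 < c_star n c"
    and "E \<in> moran_class J n c"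
  shows "convergent (sup_pre_dim n c) \<and> assouad_dim E = ereal (s_star_star n c)"
proof -
  obtain F where F: "E = moran_set n F" "moran_structure J n c F"
    using assms(7) unfolding moran_class_def by blast
  interpret moran_family n c J F
    using assms(1-6) F(2) by unfold_locales auto
  show ?thesis using convergent_sup_pre_dim assouad_dim_moran_set F(1) by simp
qed

end
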